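(* Let $(A,H,\Sigma)$ be a pseudo-ASL over a field $R$ with a pseudo-ASL term order $\preceq$ and an algebra of leading terms $A_{lt}$, and let $d:H\to\mathbb N$ be such that $\deg_d$ makes $A$ into a graded pseudo-ASL and $\preceq$ a graded pseudo-ASL term order. Let $I\subseteq A$ be a $d$-homogeneous ideal. Then defining $\deg_d$ on $A_{lt}$ so that it agrees with $\deg_d$ on $H$ makes $A_{lt}$ into a graded pseudo-ASL such that the leading ideal $LI(I)\subseteq A_{lt}$ is $d$-homogeneous, and $$H_{A/I}=H_{A_{lt}/LI(I)}.$$
   Context: All algebras are commutative, associative, unital; $R$ is a field; $\mathbb W=\{0,1,2,\dots\}$, $\mathbb N=\{1,2,\dots\}$; for finite $H$, $\mathbb W^H$ is the monoid of monomials on $H$ (written multiplicatively), and an ideal of $\mathbb W^H$ is a subset closed under multiplication by $\mathbb W^H$. Pseudo-ASL $(A,H,\Sigma)$: an $R$-algebra $A$, a finite generating set $H$, an ideal $\Sigma\subseteq\mathbb W^H$ with $H\cap\Sigma=\emptyset$, such that the products $\prod_{h}h^{m(h)}$, $m\in\mathbb W^H\setminus\Sigma$ (the standard monomials), form an $R$-basis of $A$. $LM,LT$ denote leading standard monomial and leading term for a given total order on standard monomials; $LT(0)=0$. Pseudo-ASL term order: a total order $\preceq$ on standard monomials with $1\preceq m$ for all $m$, and $LM(fh)\prec LM(gk)$ whenever $f,g,h,k$ are standard monomials with $f\prec g$, $h\preceq k$, $fh\neq0\neq gk$. Algebra of leading terms for $(A,\preceq)$: a pseudo-ASL $A_{lt}$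 with the same $(H,\Sigma)$ such that, with $\pi_{lt}:A\to A_{lt}$ the $R$-linear bijection that is the identity on standard monomials, $\pi_{lt}(m)\pi_{lt}(m')\in\{0,\pi_{lt}(LT(mm'))\}$ for all standard monomials $m,m'$. Leading ideal: $LI(I)=\langle\pi_{lt}(LT(f)):f\in I\rangle\subseteq A_{lt}$. Gradings: for $d:H\to\mathbb N$ and $m\in\mathbb W^H$, $\deg_d(m)=\sum_{h}m(h)d(h)$. $\deg_d$ makes $A$ a graded pseudo-ASL if $A=\bigoplus_{s\ge0}A_s$, with $A_s$ the $R$-span of the standard monomials of $d$-degree $s$, satisfies $A_sA_{s'}\subseteq A_{s+s'}$ (equivalently, rewriting any non-standard monomial as a combination of standard ones preserves $\deg_d$). $\preceq$ is a graded term order if $\deg_d(m)<\deg_d(m')$ implies $m\prec m'$. An ideal $I$ is $d$-homogeneous if $I=\bigoplus_s(I\cap A_s)$; then $A/I$ is graded with $(A/I)_s=A_s/(I\cap A_s)$. Hilbert–Poincaré series of a graded $R$-algebra $B$: $H_B(t)=\sum_{s\ge0}(\dim_RB_s)t^s$. *)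

theory Defs
  imports
    "Jordan_Normal_Form.Missing_VectorSpace"
    "HOL-Algebra.QuotRing"
    "HOL-Computational_Algebra.Formal_Power_Series"
begin

section \<open>Monomials\<close>

text \<open>The finite generating set is a set \<open>H\<close> of labels, so that two algebras can have
  the same generating set; a map \<open>x\<close> sends a label to the corresponding element of the algebra.
  The monoid of monomials on \<open>H\<close> is the free commutative monoid on \<open>H\<close>, that is, the
  multisets over \<open>H\<close>. The exponent of \<open>h\<close> in \<open>m\<close> is \<open>count m h\<close>, the product of two
  monomials is the sum of multisets, and the monomial \<open>1\<close> is \<open>{#}\<close>.\<close>

definition monomials :: "'h set \<Rightarrow> 'h multiset set" where
  "monomials H = {m. set_mset m \<subseteq> H}"

definition monomial_ideal :: "'h set \<Rightarrow> 'h multiset set \<Rightarrow> bool" where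
  "monomial_ideal H Sig \<longleftrightarrow>
     Sig \<subseteq> monomials H \<and> (\<forall>s\<in>Sig. \<forall>m\<in>monomials H. s + m \<in> Sig)"

definition mon_eval :: "('a, 'b) ring_scheme \<Rightarrow> ('h \<Rightarrow> 'a) \<Rightarrow> 'h multiset \<Rightarrow> 'a" where
  "mon_eval A x m = (\<Otimes>\<^bsub>A\<^esub>h\<in>set_mset m. x h [^]\<^bsub>A\<^esub> count m h)"

definition mon_deg :: "('h \<Rightarrow> nat) \<Rightarrow> 'h multiset \<Rightarrow> nat" where
  "mon_deg d m = (\<Sum>h\<in>set_mset m. count m h * d h)"

abbreviation strictly :: "('h \<times> 'h) set \<Rightarrow> 'h \<Rightarrow> 'h \<Rightarrow> bool" where
  "strictly r m m' \<equiv> (m, m') \<in> r \<and> m \<noteq> m'"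


section \<open>Direct sums, quotient algebras and Hilbert series\<close>

text \<open>\<open>U\<close> is the internal direct sum of the subspaces \<open>B s\<close>: summation is a bijection from the
  finitely supported families of elements of the \<open>B s\<close> onto \<open>U\<close>.\<close>

definition is_direct_sum :: "('a, 'b) ring_scheme \<Rightarrow> 'a set \<Rightarrow> (nat \<Rightarrow> 'a set) \<Rightarrow> bool" where
  "is_direct_sum M U B \<longleftrightarrow>
     bij_betw (\<lambda>c. \<Oplus>\<^bsub>M\<^esub>s\<in>{s. c s \<noteq> \<zero>\<^bsub>M\<^esub>}. c s)
       {c. (\<forall>s. c s \<in> B s) \<and> finite {s. c s \<noteq> \<zero>\<^bsub>M\<^esub>}} U"

text \<open>The library's quotient ring, equipped with the induced scalar multiplication.\<close>

definition quot_algebra ::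
    "('k, 'a, 'b) module_scheme \<Rightarrow> 'a set \<Rightarrow> ('k, 'a set) module" where
  "quot_algebra A I =
     ring.extend (A Quot I) (module.fields (\<lambda>c C. \<Union>a\<in>C. I +>\<^bsub>A\<^esub> (c \<odot>\<^bsub>A\<^esub> a)))"

text \<open>The \<open>R\<close>-algebra \<open>B\<close> is graded by the family of subspaces \<open>Bs\<close>. The library's \<open>dim\<close> is
  meaningful for finite-dimensional spaces; all components considered below are spanned by
  (cosets of) the finitely many standard monomials of a given degree.\<close>

definition hilbert_series ::
    "('k, 'r) ring_scheme \<Rightarrow> ('k, 'a, 'b) module_scheme \<Rightarrow> (nat \<Rightarrow> 'a set) \<Rightarrow> int fps" where
  "hilbert_series R B Bs = Abs_fps (\<lambda>s. int (vectorspace.dim R (B\<lparr>carrier := Bs s\<rparr>)))"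


section \<open>Pseudo-ASLs\<close>

text \<open>The standard monomials are a basis as an indexed family, whence the injectivity. As they
  span \<open>A\<close>, the elements \<open>x h\<close> generate \<open>A\<close> as an algebra. The zero algebra is not excluded.\<close>

locale pseudo_ASL = algebra R A + vectorspace R A
  for R :: "('k, 'r) ring_scheme" and A :: "('k, 'a, 'b) module_scheme" +
  fixes H :: "'h set" and x :: "'h \<Rightarrow> 'a" and Sig :: "'h multiset set"
  assumes finite_H: "finite H"
    and x_closed: "x \<in> H \<rightarrow> carrier A"
    and Sig_ideal: "monomial_ideal H Sig"
    and H_standard: "\<And>h. h \<in> H \<Longrightarrow> {#h#} \<notin> Sig"
    and standard_inj: "inj_on (mon_eval A x) (monomials H - Sig)"
    and standard_basis: "basis (mon_eval A x ` (monomials H - Sig))"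
begin

definition std :: "'h multiset set" where
  "std = monomials H - Sig"

text \<open>The coefficients of \<open>f\<close> with respect to the basis of standard monomials.\<close>

definition coeffs :: "'a \<Rightarrow> 'h multiset \<Rightarrow> 'k" where
  "coeffs f = (THE c. c \<in> std \<rightarrow> carrier R \<and> (\<forall>m. m \<notin> std \<longrightarrow> c m = \<zero>\<^bsub>R\<^esub>) \<and>
     finite {m. c m \<noteq> \<zero>\<^bsub>R\<^esub>} \<and>
     f = (\<Oplus>\<^bsub>A\<^esub>m\<in>{m. c m \<noteq> \<zero>\<^bsub>R\<^esub>}. c m \<odot>\<^bsub>A\<^esub> mon_eval A x m))"

definition supp :: "'a \<Rightarrow> 'h multiset set" where
  "supp f = {m. coeffs f m \<noteq> \<zero>\<^bsub>R\<^esub>}"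

text \<open>\<open>LM r f\<close> is only meaningful for nonzero \<open>f\<close>.\<close>

definition LM :: "('h multiset \<times> 'h multiset) set \<Rightarrow> 'a \<Rightarrow> 'h multiset" where
  "LM r f = (THE m. m \<in> supp f \<and> (\<forall>m'\<in>supp f. (m', m) \<in> r))"

definition LT :: "('h multiset \<times> 'h multiset) set \<Rightarrow> 'a \<Rightarrow> 'a" where
  "LT r f = (if f = \<zero>\<^bsub>A\<^esub> then \<zero>\<^bsub>A\<^esub>
     else coeffs f (LM r f) \<odot>\<^bsub>A\<^esub> mon_eval A x (LM r f))"

definition term_order :: "('h multiset \<times> 'h multiset) set \<Rightarrow> bool" where
  "term_order r \<longleftrightarrow>
     linear_order_on std r \<and>
     (\<forall>m\<in>std. ({#}, m) \<in> r) \<and>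
     (\<forall>f\<in>std. \<forall>g\<in>std. \<forall>h\<in>std. \<forall>k\<in>std.
        strictly r f g \<and> (h, k) \<in> r \<and>
        mon_eval A x f \<otimes>\<^bsub>A\<^esub> mon_eval A x h \<noteq> \<zero>\<^bsub>A\<^esub> \<and>
        mon_eval A x g \<otimes>\<^bsub>A\<^esub> mon_eval A x k \<noteq> \<zero>\<^bsub>A\<^esub> \<longrightarrow>
        strictly r (LM r (mon_eval A x f \<otimes>\<^bsub>A\<^esub> mon_eval A x h))
                   (LM r (mon_eval A x g \<otimes>\<^bsub>A\<^esub> mon_eval A x k)))"

definition component :: "('h \<Rightarrow> nat) \<Rightarrow> nat \<Rightarrow> 'a set" where
  "component d s = span (mon_eval A x ` {m \<in> std. mon_deg d m = s})"

definition graded :: "('h \<Rightarrow> nat) \<Rightarrow> bool" where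
  "graded d \<longleftrightarrow>
     is_direct_sum A (carrier A) (component d) \<and>
     (\<forall>s s'. \<forall>a\<in>component d s. \<forall>b\<in>component d s'. a \<otimes>\<^bsub>A\<^esub> b \<in> component d (s + s'))"

definition graded_order :: "('h \<Rightarrow> nat) \<Rightarrow> ('h multiset \<times> 'h multiset) set \<Rightarrow> bool" where
  "graded_order d r \<longleftrightarrow>
     (\<forall>m\<in>std. \<forall>m'\<in>std. mon_deg d m < mon_deg d m' \<longrightarrow> strictly r m m')"

definition homogeneous :: "('h \<Rightarrow> nat) \<Rightarrow> 'a set \<Rightarrow> bool" where
  "homogeneous d I \<longleftrightarrow> is_direct_sum A I (\<lambda>s. I \<inter> component d s)"

text \<open>The copy of \<open>A\<^sub>s / (I \<inter> A\<^sub>s)\<close> inside \<open>A/I\<close>, i.e. the image of \<open>A\<^sub>s\<close> in \<open>A/I\<close>.\<close>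

definition quot_component :: "('h \<Rightarrow> nat) \<Rightarrow> 'a set \<Rightarrow> nat \<Rightarrow> 'a set set" where
  "quot_component d I s = (\<lambda>a. I +>\<^bsub>A\<^esub> a) ` component d s"

definition quot_hilbert_series :: "('h \<Rightarrow> nat) \<Rightarrow> 'a set \<Rightarrow> int fps" where
  "quot_hilbert_series d I = hilbert_series R (quot_algebra A I) (quot_component d I)"

end


section \<open>Algebras of leading terms\<close>

text \<open>\<open>L\<close>, with generators \<open>y h\<close>, is an algebra of leading terms for \<open>A\<close> and the order \<open>r\<close>.
  The conditions on \<open>\<pi>\<close> determine it on \<open>carrier A\<close>.\<close>

locale algebra_of_leading_terms =
  A: pseudo_ASL R A H x Sig + L: pseudo_ASL R L H y Sig
  for R :: "('k, 'r) ring_scheme"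
    and A :: "('k, 'a, 'b) module_scheme"
    and H :: "'h set" and x :: "'h \<Rightarrow> 'a" and Sig :: "'h multiset set"
    and r :: "('h multiset \<times> 'h multiset) set"
    and L :: "('k, 'c, 'd) module_scheme"
    and y :: "'h \<Rightarrow> 'c" and \<pi> :: "'a \<Rightarrow> 'c" +
  assumes pi_linear: "linear_map R A L \<pi>"
    and pi_bij: "bij_betw \<pi> (carrier A) (carrier L)"
    and pi_standard: "\<And>m. m \<in> A.std \<Longrightarrow> \<pi> (mon_eval A x m) = mon_eval L y m"
    and pi_mult: "\<And>m m'. m \<in> A.std \<Longrightarrow> m' \<in> A.std \<Longrightarrow>
      \<pi> (mon_eval A x m) \<otimes>\<^bsub>L\<^esub> \<pi> (mon_eval A x m') \<in>
        {\<zero>\<^bsub>L\<^esub>, \<pi> (A.LT r (mon_eval A x m \<otimes>\<^bsub>A\<^esub> mon_eval A x m'))}"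
begin

definition leading_ideal :: "'a set \<Rightarrow> 'c set" where
  "leading_ideal I = Idl\<^bsub>L\<^esub> {\<pi> (A.LT r f) | f. f \<in> I}"

end

end

theory Submission
  imports Defs
begin

text \<open>Both quotients have the same monomial basis. Let \<open>M\<close> be the set of leading monomials of the
  nonzero elements of \<open>I\<close>.

  In \<open>A\<close>, the standard monomials of degree \<open>s\<close> outside \<open>M\<close> (the normal monomials) represent a basis
  of \<open>(A/I)\<^sub>s\<close>. They are independent modulo \<open>I\<close>, since a nonzero element of \<open>I\<close> has its leading
  monomial in \<open>M\<close> (\<open>dim_quot_components\<close>). They span, since a monomial in \<open>M\<close> is, modulo a
  homogeneous element of \<open>I\<close>, a combination of smaller monomials of the same degree, and there are
  only finitely many of these (\<open>normal_monomials_span\<close>).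

  In the algebra of leading terms, \<open>LI(I)\<close> is exactly the linear span of the monomials in \<open>M\<close>
  (\<open>leading_ideal_eq\<close>). What has to be shown is that this span is already closed under multiplication.
  A product \<open>y\<^sup>m y\<^sup>n\<close> is zero or a multiple of \<open>y\<^sup>l\<close>, where \<open>l\<close> is the leading monomial of
  \<open>x\<^sup>m x\<^sup>n \<noteq> 0\<close>; and if \<open>m\<close> is the leading monomial of \<open>f \<in> I\<close>, the term order axiom makes \<open>l\<close> the
  leading monomial of \<open>f x\<^sup>n \<in> I\<close> (\<open>LM_mult_stdmon\<close>). A subspace spanned by monomials is homogeneous,
  and its quotient in degree \<open>s\<close> has the normal monomials as a basis, so the two dimensions agree.

  All computations go through coordinates with respect to the basis of standard monomials: the
  span of a set of standard monomials is the set of elements whose support lies in it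
  (\<open>span_stdmon\<close>), and a subspace is the direct sum of its homogeneous components if and only if it
  contains the homogeneous parts of its elements (\<open>is_direct_sum_iff_hom_part_closed\<close>).\<close>

section \<open>Preliminaries\<close>

lemma (in vectorspace) submodule_finsum_closed:
  assumes N: "LinearCombinations.submodule K N V" and f: "f \<in> S \<rightarrow> N"
  shows "(\<Oplus>\<^bsub>V\<^esub>i\<in>S. f i) \<in> N"
  using f
proof (induction S rule: infinite_finite_induct)
  case (insert i S)
  then have "f \<in> S \<rightarrow> carrier V" "f i \<in> carrier V"
    using LinearCombinations.submodule.subset[OF N] by auto
  with insert show ?case
    using LinearCombinations.submodule.m_closed[OF N] by simp
qed (use LinearCombinations.submodule.zero_closed[OF N] in simp_all)

lemma finite_linear_order_ex_max:
  assumes r: "linear_order_on B r" and S: "finite S" "S \<noteq> {}" "S \<subseteq> B"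
  shows "\<exists>m\<in>S. \<forall>n\<in>S. (n, m) \<in> r"
  using S
proof (induction S rule: finite_ne_induct)
  case (singleton m)
  then show ?case
    using r by (auto simp: order_on_defs refl_on_def)
next
  case (insert k S)
  then obtain m where m: "m \<in> S" "\<forall>n\<in>S. (n, m) \<in> r"
    by auto
  have refl: "(k, k) \<in> r" and total: "k \<noteq> m \<Longrightarrow> (k, m) \<in> r \<or> (m, k) \<in> r" and trans: "trans r"
    using r insert.prems m(1) by (auto simp: order_on_defs refl_on_def total_on_def)
  show ?case
  proof (cases "(k, m) \<in> r")
    case False
    then have mk: "(m, k) \<in> r"
      using total refl by auto
    then have "\<forall>n\<in>S. (n, k) \<in> r"
      using m(2) transD[OF trans _ mk] by auto
    then show ?thesis
      using refl by auto
  qed (use m in auto)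
qed

text \<open>As the generators have positive degree, the size of a monomial is at most its degree.\<close>

lemma finite_mon_deg_eq:
  assumes "finite H" and "\<And>h. h \<in> H \<Longrightarrow> d h \<ge> 1"
  shows "finite {m \<in> monomials H. mon_deg d m = s}"
proof (rule finite_subset)
  have "size m \<le> mon_deg d m" if "m \<in> monomials H" for m
    unfolding size_multiset_overloaded_eq mon_deg_def
    using that assms(2) by (intro sum_mono) (force simp: monomials_def)
  then show "{m \<in> monomials H. mon_deg d m = s} \<subseteq> (\<Union>k\<le>s. multisets_of_size H k)"
    by (fastforce simp: multisets_of_size_def monomials_def)
qed (use assms(1) in auto)

context pseudo_ASL
begin

section \<open>Coordinates with respect to the standard monomials\<close>

abbreviation stdmon :: "'h multiset \<Rightarrow> 'a" where
  "stdmon \<equiv> mon_eval A x"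

lemma stdmon_closed: "m \<in> std \<Longrightarrow> stdmon m \<in> carrier A"
  using standard_basis unfolding basis_def std_def by auto

lemma stdmon_image_closed: "N \<subseteq> std \<Longrightarrow> stdmon ` N \<subseteq> carrier A"
  using stdmon_closed by auto

lemma stdmon_inj: "N \<subseteq> std \<Longrightarrow> inj_on stdmon N"
  using standard_inj unfolding std_def by (rule inj_on_subset)

lemma std_term_closed: "m \<in> std \<Longrightarrow> c \<in> carrier R \<Longrightarrow> c \<odot>\<^bsub>A\<^esub> stdmon m \<in> carrier A"
  by (simp add: stdmon_closed)

lemma std_sum_closed:
  "N \<subseteq> std \<Longrightarrow> c \<in> N \<rightarrow> carrier R \<Longrightarrow> (\<Oplus>\<^bsub>A\<^esub>m\<in>N. c m \<odot>\<^bsub>A\<^esub> stdmon m) \<in> carrier A"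
  by (intro M.finsum_closed) (auto intro!: std_term_closed)

lemma lincomb_stdmon:
  assumes "N \<subseteq> std" and "c \<in> stdmon ` N \<rightarrow> carrier R"
  shows "lincomb c (stdmon ` N) = (\<Oplus>\<^bsub>A\<^esub>m\<in>N. c (stdmon m) \<odot>\<^bsub>A\<^esub> stdmon m)"
  unfolding lincomb_def using assms
  by (intro M.finsum_reindex stdmon_inj) (auto intro!: stdmon_closed)

lemma std_sum_eq_zero:
  assumes N: "finite N" "N \<subseteq> std" and c: "c \<in> N \<rightarrow> carrier R"
    and zero: "(\<Oplus>\<^bsub>A\<^esub>m\<in>N. c m \<odot>\<^bsub>A\<^esub> stdmon m) = \<zero>\<^bsub>A\<^esub>"
    and m: "m \<in> N"
  shows "c m = \<zero>\<^bsub>R\<^esub>"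
proof -
  define b where "b = (\<lambda>v. c (the_inv_into N stdmon v))"
  have b: "b (stdmon n) = c n" if "n \<in> N" for n
    using that stdmon_inj[OF N(2)] by (simp add: b_def the_inv_into_f_f)
  have b_closed: "b \<in> stdmon ` N \<rightarrow> carrier R"
    using b c by auto
  have "lincomb b (stdmon ` N) = (\<Oplus>\<^bsub>A\<^esub>m\<in>N. c m \<odot>\<^bsub>A\<^esub> stdmon m)"
    using N(2) c b unfolding lincomb_stdmon[OF N(2) b_closed]
    by (intro M.finsum_cong') (auto intro!: std_term_closed)
  moreover have "lin_indpt (stdmon ` std)"
    using standard_basis unfolding basis_def std_def by blast
  ultimately have "b \<in> stdmon ` N \<rightarrow> {\<zero>\<^bsub>R\<^esub>}"
    using zero N b_closed by (intro not_lindepD) auto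
  then have "b (stdmon m) = \<zero>\<^bsub>R\<^esub>"
    using m by blast
  then show ?thesis
    using b[OF m] by simp
qed

lemma std_sum_extend:
  assumes "finite S" "N \<subseteq> S" "S \<subseteq> std" "c \<in> N \<rightarrow> carrier R" "\<And>m. m \<in> S - N \<Longrightarrow> c m = \<zero>\<^bsub>R\<^esub>"
  shows "(\<Oplus>\<^bsub>A\<^esub>m\<in>N. c m \<odot>\<^bsub>A\<^esub> stdmon m) = (\<Oplus>\<^bsub>A\<^esub>m\<in>S. c m \<odot>\<^bsub>A\<^esub> stdmon m)"
proof (rule M.add.finprod_mono_neutral_cong_left)
  have "c m \<in> carrier R" if "m \<in> S" for m
    using assms(4,5) that by (cases "m \<in> N") auto
  then show "(\<lambda>m. c m \<odot>\<^bsub>A\<^esub> stdmon m) \<in> S \<rightarrow> carrier A"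
    using assms(3) by (auto intro!: std_term_closed)
qed (use assms in \<open>auto intro: stdmon_closed intro!: smult_l_null\<close>)

text \<open>The property by which \<^const>\<open>coeffs\<close> is defined as a definite description.\<close>

definition coord_fun :: "('h multiset \<Rightarrow> 'k) \<Rightarrow> 'a \<Rightarrow> bool" where
  "coord_fun c f \<longleftrightarrow> c \<in> std \<rightarrow> carrier R \<and> (\<forall>m. m \<notin> std \<longrightarrow> c m = \<zero>\<^bsub>R\<^esub>) \<and>
     finite {m. c m \<noteq> \<zero>\<^bsub>R\<^esub>} \<and>
     f = (\<Oplus>\<^bsub>A\<^esub>m\<in>{m. c m \<noteq> \<zero>\<^bsub>R\<^esub>}. c m \<odot>\<^bsub>A\<^esub> stdmon m)"

lemma coord_funD:
  assumes "coord_fun c f"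
  shows "c m \<in> carrier R" "{m. c m \<noteq> \<zero>\<^bsub>R\<^esub>} \<subseteq> std" "finite {m. c m \<noteq> \<zero>\<^bsub>R\<^esub>}"
    "f = (\<Oplus>\<^bsub>A\<^esub>m\<in>{m. c m \<noteq> \<zero>\<^bsub>R\<^esub>}. c m \<odot>\<^bsub>A\<^esub> stdmon m)"
  using assms unfolding coord_fun_def by (cases "m \<in> std"; auto)+

text \<open>The difference of two coordinate functions gives a vanishing combination of standard monomials
  over the union of the two supports, so independence applies.\<close>

lemma coord_fun_unique:
  assumes c: "coord_fun c f" and b: "coord_fun b f"
  shows "c = b"
proof
  fix m
  let ?S = "{m. c m \<noteq> \<zero>\<^bsub>R\<^esub>} \<union> {m. b m \<noteq> \<zero>\<^bsub>R\<^esub>}"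
  have S: "finite ?S" "?S \<subseteq> std"
    using coord_funD(2,3)[OF c] coord_funD(2,3)[OF b] by auto
  note cl = coord_funD(1)[OF c] coord_funD(1)[OF b]
  have t: "c n \<odot>\<^bsub>A\<^esub> stdmon n \<in> carrier A" "b n \<odot>\<^bsub>A\<^esub> stdmon n \<in> carrier A"
    "(\<ominus>\<^bsub>R\<^esub> b n) \<odot>\<^bsub>A\<^esub> stdmon n \<in> carrier A" if "n \<in> ?S" for n
    using that S(2) cl by (auto intro!: std_term_closed)
  have cS: "(\<Oplus>\<^bsub>A\<^esub>m\<in>?S. c m \<odot>\<^bsub>A\<^esub> stdmon m) = f"
    by (subst coord_funD(4)[OF c], rule std_sum_extend[symmetric]) (use S cl in auto)
  have bS: "(\<Oplus>\<^bsub>A\<^esub>m\<in>?S. b m \<odot>\<^bsub>A\<^esub> stdmon m) = f"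
    by (subst coord_funD(4)[OF b], rule std_sum_extend[symmetric]) (use S cl in auto)
  have f: "f \<in> carrier A"
    unfolding cS[symmetric] using S cl by (intro std_sum_closed) auto
  \<comment> \<open>The difference is written as \<open>c m + (-1) (b m)\<close>, so that the factor \<open>-1\<close> can be pulled out of the sum.\<close>
  have "(\<Oplus>\<^bsub>A\<^esub>m\<in>?S. (c m \<oplus>\<^bsub>R\<^esub> \<ominus>\<^bsub>R\<^esub> \<one>\<^bsub>R\<^esub> \<otimes>\<^bsub>R\<^esub> b m) \<odot>\<^bsub>A\<^esub> stdmon m) =
      (\<Oplus>\<^bsub>A\<^esub>m\<in>?S. c m \<odot>\<^bsub>A\<^esub> stdmon m \<oplus>\<^bsub>A\<^esub> \<ominus>\<^bsub>R\<^esub> \<one>\<^bsub>R\<^esub> \<odot>\<^bsub>A\<^esub> (b m \<odot>\<^bsub>A\<^esub> stdmon m))"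
  proof (rule M.finsum_cong')
    fix n assume n: "n \<in> ?S"
    then have "stdmon n \<in> carrier A"
      using S(2) by (auto intro: stdmon_closed)
    then show "(c n \<oplus>\<^bsub>R\<^esub> \<ominus>\<^bsub>R\<^esub> \<one>\<^bsub>R\<^esub> \<otimes>\<^bsub>R\<^esub> b n) \<odot>\<^bsub>A\<^esub> stdmon n =
        c n \<odot>\<^bsub>A\<^esub> stdmon n \<oplus>\<^bsub>A\<^esub> \<ominus>\<^bsub>R\<^esub> \<one>\<^bsub>R\<^esub> \<odot>\<^bsub>A\<^esub> (b n \<odot>\<^bsub>A\<^esub> stdmon n)"
      using cl by (simp add: smult_l_distr smult_assoc1)
  qed (use t in auto)
  also have "\<dots> = f \<oplus>\<^bsub>A\<^esub> (\<Oplus>\<^bsub>A\<^esub>m\<in>?S. \<ominus>\<^bsub>R\<^esub> \<one>\<^bsub>R\<^esub> \<odot>\<^bsub>A\<^esub> (b m \<odot>\<^bsub>A\<^esub> stdmon m))"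
    unfolding cS[symmetric] using t by (intro M.finsum_addf) auto
  also have "(\<Oplus>\<^bsub>A\<^esub>m\<in>?S. \<ominus>\<^bsub>R\<^esub> \<one>\<^bsub>R\<^esub> \<odot>\<^bsub>A\<^esub> (b m \<odot>\<^bsub>A\<^esub> stdmon m)) = \<ominus>\<^bsub>R\<^esub> \<one>\<^bsub>R\<^esub> \<odot>\<^bsub>A\<^esub> f"
    unfolding bS[symmetric] using t by (intro finsum_smult[symmetric]) auto
  also have "f \<oplus>\<^bsub>A\<^esub> \<ominus>\<^bsub>R\<^esub> \<one>\<^bsub>R\<^esub> \<odot>\<^bsub>A\<^esub> f = \<zero>\<^bsub>A\<^esub>"
    using f by (simp add: smult_minus_1 M.r_neg)
  finally have sum0: "(\<Oplus>\<^bsub>A\<^esub>m\<in>?S. (c m \<oplus>\<^bsub>R\<^esub> \<ominus>\<^bsub>R\<^esub> \<one>\<^bsub>R\<^esub> \<otimes>\<^bsub>R\<^esub> b m) \<odot>\<^bsub>A\<^esub> stdmon m) = \<zero>\<^bsub>A\<^esub>" .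
  show "c m = b m"
  proof (cases "m \<in> ?S")
    case True
    have "c m \<oplus>\<^bsub>R\<^esub> \<ominus>\<^bsub>R\<^esub> \<one>\<^bsub>R\<^esub> \<otimes>\<^bsub>R\<^esub> b m = \<zero>\<^bsub>R\<^esub>"
      by (rule std_sum_eq_zero[OF S _ sum0 True]) (use cl in simp)
    then show ?thesis
      using cl by (simp add: R.l_minus R.add.inv_solve_right')
  qed simp
qed

lemma coord_fun_exists:
  assumes "f \<in> carrier A"
  obtains c where "coord_fun c f"
proof -
  have "f \<in> span (stdmon ` std)"
    using standard_basis assms unfolding basis_def std_def by auto
  then obtain a S' where f: "f = lincomb a S'" and S': "finite S'" "S' \<subseteq> stdmon ` std"
    and a: "a \<in> S' \<rightarrow> carrier R"
    unfolding span_def by auto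
  obtain S where S: "S \<subseteq> std" "finite S" "S' = stdmon ` S"
    using finite_subset_image[OF S'] by auto
  define c where "c = (\<lambda>m. if m \<in> S then a (stdmon m) else \<zero>\<^bsub>R\<^esub>)"
  have c: "c m \<in> carrier R" "c m \<noteq> \<zero>\<^bsub>R\<^esub> \<Longrightarrow> m \<in> S" for m
    using a S(3) by (auto simp: c_def split: if_splits)
  have "f = (\<Oplus>\<^bsub>A\<^esub>m\<in>S. c m \<odot>\<^bsub>A\<^esub> stdmon m)"
    using a S(1) unfolding f S(3) by (subst lincomb_stdmon, simp, simp, intro M.finsum_cong')
      (auto simp: c_def intro!: std_term_closed)
  also have "\<dots> = (\<Oplus>\<^bsub>A\<^esub>m\<in>{m. c m \<noteq> \<zero>\<^bsub>R\<^esub>}. c m \<odot>\<^bsub>A\<^esub> stdmon m)"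
    using S(1,2) c by (intro std_sum_extend[symmetric]) auto
  finally have "coord_fun c f"
    unfolding coord_fun_def using c S(1) finite_subset[OF _ S(2), of "{m. c m \<noteq> \<zero>\<^bsub>R\<^esub>}"] by blast
  then show thesis ..
qed

lemma coord_fun_coeffs:
  assumes "f \<in> carrier A"
  shows "coord_fun (coeffs f) f"
proof -
  obtain c where "coord_fun c f"
    using assms by (rule coord_fun_exists)
  then have "coord_fun (THE c. coord_fun c f) f"
    by (rule theI[of "\<lambda>c. coord_fun c f"]) (rule coord_fun_unique[OF _ \<open>coord_fun c f\<close>])
  then show ?thesis
    unfolding coeffs_def coord_fun_def .
qed

lemma coeffs_closed: "f \<in> carrier A \<Longrightarrow> coeffs f m \<in> carrier R"
  by (rule coord_funD(1)[OF coord_fun_coeffs])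

lemma supp_std: "f \<in> carrier A \<Longrightarrow> supp f \<subseteq> std"
  unfolding supp_def by (rule coord_funD(2)[OF coord_fun_coeffs])

lemma supp_finite: "f \<in> carrier A \<Longrightarrow> finite (supp f)"
  unfolding supp_def by (rule coord_funD(3)[OF coord_fun_coeffs])

lemma std_expansion: "f \<in> carrier A \<Longrightarrow> (\<Oplus>\<^bsub>A\<^esub>m\<in>supp f. coeffs f m \<odot>\<^bsub>A\<^esub> stdmon m) = f"
  unfolding supp_def by (rule coord_funD(4)[OF coord_fun_coeffs, symmetric])

text \<open>This reads off the coordinates of any finite combination; the rules for sums, scalar multiples
  and single monomials below are derived from it.\<close>

lemma coeffs_std_sum:
  assumes "finite N" "N \<subseteq> std" "c \<in> N \<rightarrow> carrier R"
  shows "coeffs (\<Oplus>\<^bsub>A\<^esub>m\<in>N. c m \<odot>\<^bsub>A\<^esub> stdmon m) = (\<lambda>m. if m \<in> N then c m else \<zero>\<^bsub>R\<^esub>)"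
    (is "coeffs ?f = ?c")
proof -
  have "?f = (\<Oplus>\<^bsub>A\<^esub>m\<in>N. ?c m \<odot>\<^bsub>A\<^esub> stdmon m)"
    using assms by (intro M.finsum_cong') (auto intro!: std_term_closed)
  also have "\<dots> = (\<Oplus>\<^bsub>A\<^esub>m\<in>{m. ?c m \<noteq> \<zero>\<^bsub>R\<^esub>}. ?c m \<odot>\<^bsub>A\<^esub> stdmon m)"
    using assms by (intro std_sum_extend[symmetric]) (auto split: if_splits)
  finally have "coord_fun ?c ?f"
    unfolding coord_fun_def using assms finite_subset[OF _ assms(1), of "{m. ?c m \<noteq> \<zero>\<^bsub>R\<^esub>}"]
    by (auto split: if_splits)
  then show ?thesis
    using coord_fun_unique coord_fun_coeffs std_sum_closed[OF assms(2,3)] by blast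
qed

lemma supp_iff: "m \<in> supp f \<longleftrightarrow> coeffs f m \<noteq> \<zero>\<^bsub>R\<^esub>"
  by (simp add: supp_def)

lemma coeffs_eqI:
  assumes "f \<in> carrier A" "g \<in> carrier A" "\<And>m. coeffs f m = coeffs g m"
  shows "f = g"
proof -
  have eq: "coeffs f = coeffs g"
    by (rule ext) (rule assms(3))
  have "f = (\<Oplus>\<^bsub>A\<^esub>m\<in>supp f. coeffs f m \<odot>\<^bsub>A\<^esub> stdmon m)"
    by (rule std_expansion[OF assms(1), symmetric])
  also have "\<dots> = g"
    unfolding supp_def eq unfolding supp_def[symmetric] by (rule std_expansion[OF assms(2)])
  finally show ?thesis .
qed

lemma std_expansion_superset:
  assumes f: "f \<in> carrier A" and S: "finite S" "supp f \<subseteq> S" "S \<subseteq> std"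
  shows "(\<Oplus>\<^bsub>A\<^esub>m\<in>S. coeffs f m \<odot>\<^bsub>A\<^esub> stdmon m) = f"
proof -
  have "(\<Oplus>\<^bsub>A\<^esub>m\<in>supp f. coeffs f m \<odot>\<^bsub>A\<^esub> stdmon m) = (\<Oplus>\<^bsub>A\<^esub>m\<in>S. coeffs f m \<odot>\<^bsub>A\<^esub> stdmon m)"
    by (rule std_sum_extend[OF S(1,2,3)]) (simp_all add: coeffs_closed f supp_iff)
  then show ?thesis
    using std_expansion[OF f] by simp
qed

lemma coeffs_add:
  assumes f: "f \<in> carrier A" and g: "g \<in> carrier A"
  shows "coeffs (f \<oplus>\<^bsub>A\<^esub> g) m = coeffs f m \<oplus>\<^bsub>R\<^esub> coeffs g m"
proof -
  let ?S = "supp f \<union> supp g"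
  have S: "finite ?S" "?S \<subseteq> std"
    using supp_finite supp_std f g by auto
  note cl = coeffs_closed[OF f] coeffs_closed[OF g]
  have t: "coeffs f n \<odot>\<^bsub>A\<^esub> stdmon n \<in> carrier A" "coeffs g n \<odot>\<^bsub>A\<^esub> stdmon n \<in> carrier A"
    if "n \<in> ?S" for n
    using that S cl by (auto intro!: std_term_closed)
  have "f \<oplus>\<^bsub>A\<^esub> g = (\<Oplus>\<^bsub>A\<^esub>m\<in>?S. coeffs f m \<odot>\<^bsub>A\<^esub> stdmon m) \<oplus>\<^bsub>A\<^esub>
      (\<Oplus>\<^bsub>A\<^esub>m\<in>?S. coeffs g m \<odot>\<^bsub>A\<^esub> stdmon m)"
    using S f g by (simp add: std_expansion_superset)
  also have "\<dots> = (\<Oplus>\<^bsub>A\<^esub>m\<in>?S. coeffs f m \<odot>\<^bsub>A\<^esub> stdmon m \<oplus>\<^bsub>A\<^esub> coeffs g m \<odot>\<^bsub>A\<^esub> stdmon m)"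
    using t by (intro M.finsum_addf[symmetric]) auto
  also have "\<dots> = (\<Oplus>\<^bsub>A\<^esub>m\<in>?S. (coeffs f m \<oplus>\<^bsub>R\<^esub> coeffs g m) \<odot>\<^bsub>A\<^esub> stdmon m)"
  proof (rule M.finsum_cong')
    fix n assume "n \<in> ?S"
    then have "stdmon n \<in> carrier A"
      using S(2) by (auto intro: stdmon_closed)
    then show "coeffs f n \<odot>\<^bsub>A\<^esub> stdmon n \<oplus>\<^bsub>A\<^esub> coeffs g n \<odot>\<^bsub>A\<^esub> stdmon n =
        (coeffs f n \<oplus>\<^bsub>R\<^esub> coeffs g n) \<odot>\<^bsub>A\<^esub> stdmon n"
      using cl by (simp add: smult_l_distr)
  qed (use S cl in \<open>auto intro!: std_term_closed\<close>)
  finally have "coeffs (f \<oplus>\<^bsub>A\<^esub> g) m =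
      (if m \<in> ?S then coeffs f m \<oplus>\<^bsub>R\<^esub> coeffs g m else \<zero>\<^bsub>R\<^esub>)"
    using coeffs_std_sum[OF S, of "\<lambda>m. coeffs f m \<oplus>\<^bsub>R\<^esub> coeffs g m"] cl by simp
  then show ?thesis
    by (auto simp: supp_iff)
qed

lemma coeffs_smult:
  assumes f: "f \<in> carrier A" and c: "c \<in> carrier R"
  shows "coeffs (c \<odot>\<^bsub>A\<^esub> f) m = c \<otimes>\<^bsub>R\<^esub> coeffs f m"
proof -
  note S = supp_finite[OF f] supp_std[OF f] and cl = coeffs_closed[OF f]
  have "c \<odot>\<^bsub>A\<^esub> f = c \<odot>\<^bsub>A\<^esub> (\<Oplus>\<^bsub>A\<^esub>m\<in>supp f. coeffs f m \<odot>\<^bsub>A\<^esub> stdmon m)"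
    by (simp add: std_expansion f)
  also have "\<dots> = (\<Oplus>\<^bsub>A\<^esub>m\<in>supp f. c \<odot>\<^bsub>A\<^esub> (coeffs f m \<odot>\<^bsub>A\<^esub> stdmon m))"
    using S c cl by (intro finsum_smult) (auto intro!: std_term_closed)
  also have "\<dots> = (\<Oplus>\<^bsub>A\<^esub>m\<in>supp f. (c \<otimes>\<^bsub>R\<^esub> coeffs f m) \<odot>\<^bsub>A\<^esub> stdmon m)"
    using S c cl by (intro M.finsum_cong') (auto intro!: std_term_closed smult_assoc1[symmetric] stdmon_closed)
  finally have "coeffs (c \<odot>\<^bsub>A\<^esub> f) m = (if m \<in> supp f then c \<otimes>\<^bsub>R\<^esub> coeffs f m else \<zero>\<^bsub>R\<^esub>)"
    using coeffs_std_sum[OF S, of "\<lambda>m. c \<otimes>\<^bsub>R\<^esub> coeffs f m"] c cl by simp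
  then show ?thesis
    using c by (auto simp: supp_iff)
qed

lemma coeffs_zero: "coeffs \<zero>\<^bsub>A\<^esub> m = \<zero>\<^bsub>R\<^esub>"
  using coeffs_std_sum[of "{}"] by simp

lemma coeffs_stdmon:
  assumes "n \<in> std"
  shows "coeffs (stdmon n) m = (if m = n then \<one>\<^bsub>R\<^esub> else \<zero>\<^bsub>R\<^esub>)"
  using coeffs_std_sum[of "{n}" "\<lambda>_. \<one>\<^bsub>R\<^esub>"] assms stdmon_closed[OF assms] by simp

lemma coeffs_finsum:
  assumes "f \<in> S \<rightarrow> carrier A"
  shows "coeffs (\<Oplus>\<^bsub>A\<^esub>i\<in>S. f i) m = (\<Oplus>\<^bsub>R\<^esub>i\<in>S. coeffs (f i) m)"
  using assms
proof (induction S rule: infinite_finite_induct)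
  case (insert i S)
  have f: "f \<in> S \<rightarrow> carrier A" "f i \<in> carrier A"
    using insert.prems by auto
  then have "coeffs (\<Oplus>\<^bsub>A\<^esub>i\<in>insert i S. f i) m = coeffs (f i) m \<oplus>\<^bsub>R\<^esub> (\<Oplus>\<^bsub>R\<^esub>i\<in>S. coeffs (f i) m)"
    using insert.hyps insert.IH by (simp add: coeffs_add)
  also have "\<dots> = (\<Oplus>\<^bsub>R\<^esub>i\<in>insert i S. coeffs (f i) m)"
    using insert.hyps f by (intro R.finsum_insert[symmetric]) (auto intro!: coeffs_closed)
  finally show ?case .
qed (simp_all add: coeffs_zero)

lemma supp_eq_empty_iff: "f \<in> carrier A \<Longrightarrow> supp f = {} \<longleftrightarrow> f = \<zero>\<^bsub>A\<^esub>"
  using coeffs_eqI[of f "\<zero>\<^bsub>A\<^esub>"] by (auto simp: supp_def coeffs_zero)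

lemma supp_stdmon: "m \<in> std \<Longrightarrow> supp (stdmon m) = {m}"
  by (auto simp: supp_def coeffs_stdmon)

lemma supp_stdD: "m \<in> supp f \<Longrightarrow> f \<in> carrier A \<Longrightarrow> m \<in> std"
  using supp_std by blast

section \<open>Subspaces and supports\<close>

lemma supp_subset_submodule:
  "LinearCombinations.submodule R {f \<in> carrier A. supp f \<subseteq> N} A"
proof (rule LinearCombinations.submodule.intro)
  show "\<zero>\<^bsub>A\<^esub> \<in> {f \<in> carrier A. supp f \<subseteq> N}"
    by (auto simp: supp_iff coeffs_zero)
next
  fix v w assume vw: "v \<in> {f \<in> carrier A. supp f \<subseteq> N}" "w \<in> {f \<in> carrier A. supp f \<subseteq> N}"
  have "supp (v \<oplus>\<^bsub>A\<^esub> w) \<subseteq> supp v \<union> supp w"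
    using vw by (auto simp: supp_iff coeffs_add)
  with vw show "v \<oplus>\<^bsub>A\<^esub> w \<in> {f \<in> carrier A. supp f \<subseteq> N}"
    by auto
next
  fix c v assume cv: "c \<in> carrier R" "v \<in> {f \<in> carrier A. supp f \<subseteq> N}"
  have "supp (c \<odot>\<^bsub>A\<^esub> v) \<subseteq> supp v"
    using cv by (auto simp: supp_iff coeffs_smult)
  with cv show "c \<odot>\<^bsub>A\<^esub> v \<in> {f \<in> carrier A. supp f \<subseteq> N}"
    by auto
qed (auto intro: module_axioms)

lemma in_submodule_if_supp:
  assumes B: "LinearCombinations.submodule R B A" and f: "f \<in> carrier A"
    and supp: "\<And>m. m \<in> supp f \<Longrightarrow> stdmon m \<in> B"
  shows "f \<in> B"
proof -
  have "(\<Oplus>\<^bsub>A\<^esub>m\<in>supp f. coeffs f m \<odot>\<^bsub>A\<^esub> stdmon m) \<in> B"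
    using supp coeffs_closed[OF f] LinearCombinations.submodule.smult_closed[OF B]
    by (intro submodule_finsum_closed[OF B]) auto
  then show ?thesis
    by (simp add: std_expansion f)
qed

lemma span_stdmon:
  assumes "N \<subseteq> std"
  shows "span (stdmon ` N) = {f \<in> carrier A. supp f \<subseteq> N}"
proof
  show "span (stdmon ` N) \<subseteq> {f \<in> carrier A. supp f \<subseteq> N}"
    using assms by (intro span_is_subset supp_subset_submodule) (auto simp: supp_stdmon stdmon_closed)
  have "stdmon ` N \<subseteq> span (stdmon ` N)"
    using assms by (intro in_own_span stdmon_image_closed)
  then show "{f \<in> carrier A. supp f \<subseteq> N} \<subseteq> span (stdmon ` N)"
    using assms in_submodule_if_supp[OF span_is_submodule[OF stdmon_image_closed[OF assms]]] by blast
qed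

text \<open>Combined with \<open>in_submodule_if_supp\<close>, this reduces membership of a product to the case of
  monomial factors, one factor at a time.\<close>

lemma submodule_multiplier:
  assumes B: "LinearCombinations.submodule R B A" and k: "k \<in> carrier A"
  shows "LinearCombinations.submodule R {h \<in> carrier A. h \<otimes>\<^bsub>A\<^esub> k \<in> B} A"
proof (rule LinearCombinations.submodule.intro)
  note closed = LinearCombinations.submodule.m_closed[OF B]
    LinearCombinations.submodule.zero_closed[OF B] LinearCombinations.submodule.smult_closed[OF B]
  show "\<zero>\<^bsub>A\<^esub> \<in> {h \<in> carrier A. h \<otimes>\<^bsub>A\<^esub> k \<in> B}"
    using closed(2) k by simp
  show "v \<oplus>\<^bsub>A\<^esub> w \<in> {h \<in> carrier A. h \<otimes>\<^bsub>A\<^esub> k \<in> B}"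
    if "v \<in> {h \<in> carrier A. h \<otimes>\<^bsub>A\<^esub> k \<in> B}" "w \<in> {h \<in> carrier A. h \<otimes>\<^bsub>A\<^esub> k \<in> B}" for v w
    using that closed(1)[of "v \<otimes>\<^bsub>A\<^esub> k" "w \<otimes>\<^bsub>A\<^esub> k"] k by (simp add: l_distr)
  show "c \<odot>\<^bsub>A\<^esub> v \<in> {h \<in> carrier A. h \<otimes>\<^bsub>A\<^esub> k \<in> B}"
    if "c \<in> carrier R" "v \<in> {h \<in> carrier A. h \<otimes>\<^bsub>A\<^esub> k \<in> B}" for c v
    using that closed(3)[of c "v \<otimes>\<^bsub>A\<^esub> k"] k by (simp add: smult_assoc2)
qed (use module_axioms in auto)

lemma mult_in_submodule_if_supp:
  assumes B: "LinearCombinations.submodule R B A" and f: "f \<in> carrier A" and g: "g \<in> carrier A"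
    and supp: "\<And>m n. m \<in> supp f \<Longrightarrow> n \<in> supp g \<Longrightarrow> stdmon m \<otimes>\<^bsub>A\<^esub> stdmon n \<in> B"
  shows "f \<otimes>\<^bsub>A\<^esub> g \<in> B"
proof -
  have "stdmon m \<otimes>\<^bsub>A\<^esub> g \<in> B" if m: "m \<in> supp f" for m
  proof -
    have x: "stdmon m \<in> carrier A"
      by (rule stdmon_closed[OF supp_stdD[OF m f]])
    have "stdmon n \<in> {h \<in> carrier A. h \<otimes>\<^bsub>A\<^esub> stdmon m \<in> B}" if n: "n \<in> supp g" for n
      using supp[OF m n] stdmon_closed[OF supp_stdD[OF n g]] x by (simp add: m_comm)
    then have "g \<in> {h \<in> carrier A. h \<otimes>\<^bsub>A\<^esub> stdmon m \<in> B}"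
      by (rule in_submodule_if_supp[OF submodule_multiplier[OF B x] g])
    then show ?thesis
      using x by (simp add: m_comm)
  qed
  then have "stdmon m \<in> {h \<in> carrier A. h \<otimes>\<^bsub>A\<^esub> g \<in> B}" if m: "m \<in> supp f" for m
    using m stdmon_closed[OF supp_stdD[OF m f]] by simp
  then have "f \<in> {h \<in> carrier A. h \<otimes>\<^bsub>A\<^esub> g \<in> B}"
    by (rule in_submodule_if_supp[OF submodule_multiplier[OF B g] f])
  then show ?thesis by simp
qed

lemma submodule_smult_cancel:
  assumes B: "LinearCombinations.submodule R B A" and v: "v \<in> carrier A"
    and c: "c \<in> carrier R" "c \<noteq> \<zero>\<^bsub>R\<^esub>" and cv: "c \<odot>\<^bsub>A\<^esub> v \<in> B"
  shows "v \<in> B"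
proof -
  have "inv\<^bsub>R\<^esub> c \<in> carrier R"
    using c field_Units R.Units_inv_closed by blast
  then have "inv\<^bsub>R\<^esub> c \<odot>\<^bsub>A\<^esub> (c \<odot>\<^bsub>A\<^esub> v) \<in> B"
    by (rule LinearCombinations.submodule.smult_closed[OF B _ cv])
  then show ?thesis
    using mult_inverse[OF c(1) v refl c(2)] by simp
qed

lemma submodule_diff_closed:
  assumes B: "LinearCombinations.submodule R B A" and v: "v \<in> B" and w: "w \<in> B"
  shows "v \<ominus>\<^bsub>A\<^esub> w \<in> B"
proof -
  have "w \<in> carrier A"
    using LinearCombinations.submodule.subset[OF B] w by auto
  then have "v \<ominus>\<^bsub>A\<^esub> w = v \<oplus>\<^bsub>A\<^esub> (\<ominus>\<^bsub>R\<^esub> \<one>\<^bsub>R\<^esub>) \<odot>\<^bsub>A\<^esub> w"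
    by (simp add: smult_minus_1 M.minus_eq)
  also have "\<dots> \<in> B"
    using v w by (intro LinearCombinations.submodule.m_closed[OF B]
      LinearCombinations.submodule.smult_closed[OF B]) simp_all
  finally show ?thesis .
qed

text \<open>Multiplication by the scalar \<open>c\<close> is multiplication by the algebra element \<open>c \<cdot> 1\<close>.\<close>

lemma ideal_submodule:
  assumes "ideal I A"
  shows "LinearCombinations.submodule R I A"
proof -
  interpret I: ideal I A by fact
  have "c \<odot>\<^bsub>A\<^esub> v \<in> I" if c: "c \<in> carrier R" and v: "v \<in> I" for c v
  proof -
    have "c \<odot>\<^bsub>A\<^esub> v = (c \<odot>\<^bsub>A\<^esub> \<one>\<^bsub>A\<^esub>) \<otimes>\<^bsub>A\<^esub> v"
      using c v I.Icarr by (simp add: smult_assoc2)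
    also have "\<dots> \<in> I"
      using c v by (simp add: I.I_l_closed)
    finally show ?thesis .
  qed
  then show ?thesis
    using I.a_subset I.a_closed I.zero_closed by (intro LinearCombinations.submodule.intro) (auto intro: module_axioms)
qed

text \<open>Closure under negation holds in every subspace, because \<open>- v\<close> is the scalar multiple
  \<open>(-1) v\<close>.\<close>

lemma submodule_idealI:
  assumes B: "LinearCombinations.submodule R B A"
    and mult: "\<And>a b. a \<in> carrier A \<Longrightarrow> b \<in> B \<Longrightarrow> a \<otimes>\<^bsub>A\<^esub> b \<in> B"
  shows "ideal B A"
proof (rule idealI)
  note closed = LinearCombinations.submodule.subset[OF B] LinearCombinations.submodule.zero_closed[OF B]
  have "\<ominus>\<^bsub>A\<^esub> v \<in> B" if v: "v \<in> B" for v
    using submodule_diff_closed[OF B closed(2) v] v closed(1) by (auto simp: M.minus_eq)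
  then show "subgroup B (add_monoid A)"
    using closed LinearCombinations.submodule.m_closed[OF B]
    by (intro M.add.subgroupI) (auto simp: a_inv_def)
  show "b \<otimes>\<^bsub>A\<^esub> a \<in> B" if "b \<in> B" "a \<in> carrier A" for a b
    using mult[OF that(2,1)] that closed(1) m_comm[of a b] by auto
qed (use mult ring_axioms in auto)

section \<open>Homogeneous parts and direct sums\<close>

lemma component_eq: "component d s = {f \<in> carrier A. \<forall>m\<in>supp f. mon_deg d m = s}"
proof -
  have "supp f \<subseteq> {m \<in> std. mon_deg d m = s} \<longleftrightarrow> (\<forall>m\<in>supp f. mon_deg d m = s)" if "f \<in> carrier A" for f
    using supp_std[OF that] by auto
  then show ?thesis
    unfolding component_def by (subst span_stdmon) auto
qed

lemma component_submodule: "LinearCombinations.submodule R (component d s) A"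
  unfolding component_def by (intro span_is_submodule stdmon_image_closed) auto

definition hom_part :: "('h \<Rightarrow> nat) \<Rightarrow> nat \<Rightarrow> 'a \<Rightarrow> 'a" where
  "hom_part d s f = (\<Oplus>\<^bsub>A\<^esub>m\<in>{m \<in> supp f. mon_deg d m = s}. coeffs f m \<odot>\<^bsub>A\<^esub> stdmon m)"

lemma coeffs_hom_part:
  assumes "f \<in> carrier A"
  shows "coeffs (hom_part d s f) m = (if mon_deg d m = s then coeffs f m else \<zero>\<^bsub>R\<^esub>)"
proof -
  let ?N = "{m \<in> supp f. mon_deg d m = s}"
  have "finite ?N" "?N \<subseteq> std" "coeffs f \<in> ?N \<rightarrow> carrier R"
    using supp_std[OF assms] supp_finite[OF assms] coeffs_closed[OF assms] by auto
  then show ?thesis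
    unfolding hom_part_def by (simp add: coeffs_std_sum supp_iff)
qed

lemma hom_part_closed: "f \<in> carrier A \<Longrightarrow> hom_part d s f \<in> carrier A"
  unfolding hom_part_def by (intro std_sum_closed) (auto simp: coeffs_closed supp_stdD)

lemma supp_hom_part: "f \<in> carrier A \<Longrightarrow> supp (hom_part d s f) = {m \<in> supp f. mon_deg d m = s}"
  by (auto simp: supp_iff coeffs_hom_part split: if_splits)

lemma hom_part_component: "f \<in> carrier A \<Longrightarrow> hom_part d s f \<in> component d s"
  by (simp add: component_eq hom_part_closed supp_hom_part)

text \<open>Only the summand of degree \<open>mon_deg d m\<close> can contain the monomial \<open>m\<close>. Hence the summands are
  recovered from the sum as its homogeneous parts.\<close>

lemma coeffs_component_sum:
  assumes c: "\<And>s. c s \<in> component d s" and fin: "finite {s. c s \<noteq> \<zero>\<^bsub>A\<^esub>}"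
  shows "coeffs (\<Oplus>\<^bsub>A\<^esub>s\<in>{s. c s \<noteq> \<zero>\<^bsub>A\<^esub>}. c s) m = coeffs (c (mon_deg d m)) m"
proof -
  let ?S = "{s. c s \<noteq> \<zero>\<^bsub>A\<^esub>}"
  have closed: "c s \<in> carrier A" for s
    using c[of s] by (simp add: component_eq)
  have zero: "coeffs (c s) m = \<zero>\<^bsub>R\<^esub>" if "s \<noteq> mon_deg d m" for s
    using c[of s] that by (auto simp: component_eq supp_iff)
  have "coeffs (\<Oplus>\<^bsub>A\<^esub>s\<in>?S. c s) m = (\<Oplus>\<^bsub>R\<^esub>s\<in>?S. coeffs (c s) m)"
    using closed by (intro coeffs_finsum) auto
  also have "\<dots> = (\<Oplus>\<^bsub>R\<^esub>s\<in>insert (mon_deg d m) ?S. coeffs (c s) m)"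
    using fin closed by (intro R.add.finprod_mono_neutral_cong_left) (auto simp: coeffs_closed coeffs_zero)
  also have "\<dots> = (\<Oplus>\<^bsub>R\<^esub>s\<in>{mon_deg d m}. coeffs (c s) m)"
    using fin closed zero
    by (intro R.add.finprod_mono_neutral_cong_right) (auto simp: coeffs_closed coeffs_zero)
  also have "\<dots> = coeffs (c (mon_deg d m)) m"
    using closed by (simp add: coeffs_closed)
  finally show ?thesis .
qed

text \<open>Summation of a family of homogeneous elements is always injective, since the homogeneous parts
  invert it. So only surjectivity onto \<open>U\<close> matters, and the unique candidate for a preimage of \<open>f\<close>
  is the family of its homogeneous parts.\<close>

lemma is_direct_sum_iff_hom_part_closed:
  assumes U: "LinearCombinations.submodule R U A"
  shows "is_direct_sum A U (\<lambda>s. U \<inter> component d s) \<longleftrightarrow> (\<forall>f\<in>U. \<forall>s. hom_part d s f \<in> U)"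
proof -
  interpret U: LinearCombinations.submodule R U A by fact
  define C where "C = {c. (\<forall>s. c s \<in> U \<inter> component d s) \<and> finite {s. c s \<noteq> \<zero>\<^bsub>A\<^esub>}}"
  define \<Phi> where "\<Phi> = (\<lambda>c. \<Oplus>\<^bsub>A\<^esub>s\<in>{s::nat. c s \<noteq> \<zero>\<^bsub>A\<^esub>}. c s)"
  have coeffs_\<Phi>: "coeffs (\<Phi> c) m = coeffs (c (mon_deg d m)) m" if "c \<in> C" for c m
    using that unfolding C_def \<Phi>_def by (intro coeffs_component_sum) auto
  have \<Phi>_closed: "\<Phi> c \<in> U" if "c \<in> C" for c
    using that unfolding C_def \<Phi>_def by (intro submodule_finsum_closed[OF U]) auto
  have U_closed: "f \<in> carrier A" if "f \<in> U" for f
    using that U.subset by auto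
  have \<Phi>_parts: "hom_part d s (\<Phi> c) = c s" if c: "c \<in> C" for c s
  proof (rule coeffs_eqI)
    have cs: "c s \<in> component d s"
      using c by (auto simp: C_def)
    then show "c s \<in> carrier A"
      by (simp add: component_eq)
    show "coeffs (hom_part d s (\<Phi> c)) m = coeffs (c s) m" for m
      using cs by (auto simp: coeffs_hom_part U_closed \<Phi>_closed c coeffs_\<Phi> component_eq supp_iff)
  qed (simp add: hom_part_closed U_closed \<Phi>_closed c)
  have inj: "inj_on \<Phi> C"
  proof (rule inj_onI)
    fix b c assume "b \<in> C" "c \<in> C" "\<Phi> b = \<Phi> c"
    then have "b s = c s" for s
      using \<Phi>_parts[of b s] \<Phi>_parts[of c s] by simp
    then show "b = c" by (rule ext)
  qed
  have "\<Phi> ` C = U \<longleftrightarrow> (\<forall>f\<in>U. \<forall>s. hom_part d s f \<in> U)"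
  proof
    assume "\<Phi> ` C = U"
    show "\<forall>f\<in>U. \<forall>s. hom_part d s f \<in> U"
    proof (intro ballI allI)
      fix f s assume "f \<in> U"
      then obtain c where "f = \<Phi> c" "c \<in> C"
        using \<open>\<Phi> ` C = U\<close> by auto
      then show "hom_part d s f \<in> U"
        by (simp add: \<Phi>_parts) (simp add: C_def)
    qed
  next
    assume parts: "\<forall>f\<in>U. \<forall>s. hom_part d s f \<in> U"
    have "f \<in> \<Phi> ` C" if f: "f \<in> U" for f
    proof
      let ?c = "\<lambda>s. hom_part d s f"
      note fA = U_closed[OF f]
      have "{s. ?c s \<noteq> \<zero>\<^bsub>A\<^esub>} \<subseteq> mon_deg d ` supp f"
        using fA by (auto simp: supp_eq_empty_iff[symmetric] hom_part_closed supp_hom_part)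
      then have "finite {s. ?c s \<noteq> \<zero>\<^bsub>A\<^esub>}"
        by (rule finite_subset) (simp add: supp_finite fA)
      then show c: "?c \<in> C"
        unfolding C_def using parts f fA by (auto simp: hom_part_component)
      show "f = \<Phi> ?c"
        using c fA U_closed[OF \<Phi>_closed[OF c]]
        by (intro coeffs_eqI) (simp_all add: coeffs_\<Phi> coeffs_hom_part)
    qed
    then show "\<Phi> ` C = U"
      using \<Phi>_closed by auto
  qed
  then show ?thesis
    using inj unfolding is_direct_sum_def bij_betw_def C_def \<Phi>_def by simp
qed

lemma carrier_submodule: "LinearCombinations.submodule R (carrier A) A"
  by (intro LinearCombinations.submodule.intro) (auto intro: module_axioms)

lemma components_direct_sum: "is_direct_sum A (carrier A) (component d)"
proof -
  have "carrier A \<inter> component d s = component d s" for s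
    by (auto simp: component_eq)
  then show ?thesis
    using is_direct_sum_iff_hom_part_closed[OF carrier_submodule, of d] by (simp add: hom_part_closed)
qed

lemma gradedI:
  assumes prod: "\<And>m n. m \<in> std \<Longrightarrow> n \<in> std \<Longrightarrow>
    stdmon m \<otimes>\<^bsub>A\<^esub> stdmon n \<in> component d (mon_deg d m + mon_deg d n)"
  shows "graded d"
  unfolding graded_def
proof (intro conjI components_direct_sum allI ballI)
  fix s s' a b assume a: "a \<in> component d s" and b: "b \<in> component d s'"
  have aA: "a \<in> carrier A" and bA: "b \<in> carrier A"
    using a b by (simp_all add: component_eq)
  show "a \<otimes>\<^bsub>A\<^esub> b \<in> component d (s + s')"
  proof (rule mult_in_submodule_if_supp, rule component_submodule, rule aA, rule bA)
    fix m n assume m: "m \<in> supp a" and n: "n \<in> supp b"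
    have "mon_deg d m = s" "mon_deg d n = s'"
      using a b m n by (simp_all add: component_eq)
    then show "stdmon m \<otimes>\<^bsub>A\<^esub> stdmon n \<in> component d (s + s')"
      using prod[OF supp_stdD[OF m aA] supp_stdD[OF n bA]] by simp
  qed
qed

section \<open>Leading monomials\<close>

lemma split_std_term:
  assumes f: "f \<in> carrier A" and m: "m \<in> std"
  obtains h where "h \<in> carrier A" "f = coeffs f m \<odot>\<^bsub>A\<^esub> stdmon m \<oplus>\<^bsub>A\<^esub> h" "supp h = supp f - {m}"
proof
  define t where "t = coeffs f m \<odot>\<^bsub>A\<^esub> stdmon m"
  define h where "h = f \<oplus>\<^bsub>A\<^esub> (\<ominus>\<^bsub>R\<^esub> \<one>\<^bsub>R\<^esub>) \<odot>\<^bsub>A\<^esub> t"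
  have t: "t \<in> carrier A"
    using f m by (simp add: t_def std_term_closed coeffs_closed)
  then show h: "h \<in> carrier A"
    using f by (simp add: h_def)
  have "coeffs h n = coeffs f n \<oplus>\<^bsub>R\<^esub> (\<ominus>\<^bsub>R\<^esub> \<one>\<^bsub>R\<^esub>) \<otimes>\<^bsub>R\<^esub> (coeffs f m \<otimes>\<^bsub>R\<^esub> (if n = m then \<one>\<^bsub>R\<^esub> else \<zero>\<^bsub>R\<^esub>))" for n
    unfolding h_def using f m t
    by (simp add: coeffs_add coeffs_smult t_def coeffs_stdmon stdmon_closed coeffs_closed)
  then have "coeffs h n = (if n = m then \<zero>\<^bsub>R\<^esub> else coeffs f n)" for n
    using coeffs_closed[OF f] by (simp add: R.l_minus R.r_neg)
  then show "supp h = supp f - {m}"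
    by (auto simp: supp_iff split: if_splits)
  have "t \<oplus>\<^bsub>A\<^esub> h = f"
    using f t by (simp add: h_def smult_minus_1 M.a_ac M.r_neg1 M.r_neg)
  then show "f = coeffs f m \<odot>\<^bsub>A\<^esub> stdmon m \<oplus>\<^bsub>A\<^esub> h"
    by (simp add: t_def)
qed

lemma LM_properties:
  assumes r: "linear_order_on std r" and f: "f \<in> carrier A" "f \<noteq> \<zero>\<^bsub>A\<^esub>"
  shows "LM r f \<in> supp f" and "m \<in> supp f \<Longrightarrow> (m, LM r f) \<in> r"
proof -
  have "antisym r"
    using r by (auto simp: order_on_defs)
  moreover obtain m where "m \<in> supp f" "\<forall>n\<in>supp f. (n, m) \<in> r"
    using finite_linear_order_ex_max[OF r supp_finite[OF f(1)] _ supp_std[OF f(1)]]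
      supp_eq_empty_iff[OF f(1)] f(2) by auto
  ultimately have "\<exists>!m. m \<in> supp f \<and> (\<forall>n\<in>supp f. (n, m) \<in> r)"
    by (intro ex1I[of _ m]) (auto dest: antisymD)
  from theI'[OF this] show "LM r f \<in> supp f" "m \<in> supp f \<Longrightarrow> (m, LM r f) \<in> r" for m
    unfolding LM_def by blast+
qed

lemma LM_std: "linear_order_on std r \<Longrightarrow> f \<in> carrier A \<Longrightarrow> f \<noteq> \<zero>\<^bsub>A\<^esub> \<Longrightarrow> LM r f \<in> std"
  using LM_properties(1) supp_stdD by blast

lemma LM_eqI:
  assumes r: "linear_order_on std r" and f: "f \<in> carrier A" and m: "m \<in> supp f" "\<And>n. n \<in> supp f \<Longrightarrow> (n, m) \<in> r"
  shows "LM r f = m"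
proof -
  have "f \<noteq> \<zero>\<^bsub>A\<^esub>"
    using m(1) supp_eq_empty_iff[OF f] by auto
  then have "(LM r f, m) \<in> r" "(m, LM r f) \<in> r"
    using LM_properties[OF r f] m by auto
  then show ?thesis
    using r by (auto simp: order_on_defs dest: antisymD)
qed

text \<open>Let \<open>m\<close> be the leading monomial of \<open>f\<close>. For every other \<open>k\<close> in the support of \<open>f\<close> the term order
  axiom puts all monomials of \<open>x\<^sup>k x\<^sup>n\<close> strictly below the leading monomial of \<open>x\<^sup>m x\<^sup>n\<close>, or else
  \<open>x\<^sup>k x\<^sup>n = 0\<close>. So nothing cancels the leading term of \<open>x\<^sup>m x\<^sup>n\<close>. The hypothesis
  \<open>x\<^sup>m x\<^sup>n \<noteq> 0\<close> is essential, because the axiom compares nonzero products only.\<close>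

lemma LM_mult_stdmon:
  assumes r: "term_order r" and f: "f \<in> carrier A" "f \<noteq> \<zero>\<^bsub>A\<^esub>" and n: "n \<in> std"
    and nz: "stdmon (LM r f) \<otimes>\<^bsub>A\<^esub> stdmon n \<noteq> \<zero>\<^bsub>A\<^esub>"
  shows "f \<otimes>\<^bsub>A\<^esub> stdmon n \<noteq> \<zero>\<^bsub>A\<^esub>" (is ?nonzero)
    and "LM r (f \<otimes>\<^bsub>A\<^esub> stdmon n) = LM r (stdmon (LM r f) \<otimes>\<^bsub>A\<^esub> stdmon n)" (is ?LM)
proof -
  have lin: "linear_order_on std r"
    using r by (simp add: term_order_def)
  then have trans: "trans r" and antisym: "antisym r" and refl: "(n, n) \<in> r"
    using n by (auto simp: order_on_defs refl_on_def)
  define m where "m = LM r f"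
  define p where "p = stdmon m \<otimes>\<^bsub>A\<^esub> stdmon n"
  have m: "m \<in> std" "m \<in> supp f"
    using LM_std[OF lin f] LM_properties(1)[OF lin f] by (simp_all add: m_def)
  have p: "p \<in> carrier A" "p \<noteq> \<zero>\<^bsub>A\<^esub>"
    using m n nz by (simp_all add: p_def m_def[symmetric] stdmon_closed)
  \<comment> \<open>The subspace of elements all of whose monomials lie strictly below the leading monomial of \<open>p\<close>;
    it will contain the product with the tail \<open>h\<close> of \<open>f\<close>.\<close>
  define B where "B = {g \<in> carrier A. supp g \<subseteq> {q. strictly r q (LM r p)}}"
  obtain h where h: "h \<in> carrier A" "f = coeffs f m \<odot>\<^bsub>A\<^esub> stdmon m \<oplus>\<^bsub>A\<^esub> h" "supp h = supp f - {m}"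
    using split_std_term[OF f(1) m(1)] .
  have "h \<otimes>\<^bsub>A\<^esub> stdmon n \<in> B"
  proof (rule mult_in_submodule_if_supp)
    show "LinearCombinations.submodule R B A"
      unfolding B_def by (rule supp_subset_submodule)
    fix k n' assume k: "k \<in> supp h" and "n' \<in> supp (stdmon n)"
    then have n': "n' = n"
      using supp_stdmon[OF n] by simp
    define q where "q = stdmon k \<otimes>\<^bsub>A\<^esub> stdmon n"
    have kstd: "k \<in> std" and km: "strictly r k m"
      using k h(3) supp_stdD[OF _ f(1)] LM_properties(2)[OF lin f] by (auto simp: m_def)
    have q: "q \<in> carrier A"
      using kstd n by (simp add: q_def stdmon_closed)
    have "strictly r j (LM r p)" if j: "j \<in> supp q" for j
    proof -
      have "q \<noteq> \<zero>\<^bsub>A\<^esub>"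
        using j supp_eq_empty_iff[OF q] by auto
      then have "strictly r (LM r q) (LM r p)"
        using r kstd m(1) n km refl p(2) unfolding term_order_def p_def q_def by blast
      moreover have "(j, LM r q) \<in> r"
        using LM_properties(2)[OF lin q \<open>q \<noteq> \<zero>\<^bsub>A\<^esub>\<close> j] .
      ultimately show ?thesis
        using transD[OF trans] antisymD[OF antisym] by metis
    qed
    then show "stdmon k \<otimes>\<^bsub>A\<^esub> stdmon n' \<in> B"
      using q by (auto simp: B_def n' q_def)
  qed (use h n in \<open>auto simp: stdmon_closed\<close>)
  then have hn: "h \<otimes>\<^bsub>A\<^esub> stdmon n \<in> carrier A" "supp (h \<otimes>\<^bsub>A\<^esub> stdmon n) \<subseteq> {q. strictly r q (LM r p)}"
    by (simp_all add: B_def)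
  define c where "c = coeffs f m"
  have c: "c \<in> carrier R" "c \<noteq> \<zero>\<^bsub>R\<^esub>"
    using m(2) coeffs_closed[OF f(1)] by (simp_all add: c_def supp_iff)
  have "f \<otimes>\<^bsub>A\<^esub> stdmon n = (c \<odot>\<^bsub>A\<^esub> stdmon m \<oplus>\<^bsub>A\<^esub> h) \<otimes>\<^bsub>A\<^esub> stdmon n"
    using h(2) by (simp add: c_def)
  also have "\<dots> = c \<odot>\<^bsub>A\<^esub> p \<oplus>\<^bsub>A\<^esub> h \<otimes>\<^bsub>A\<^esub> stdmon n"
    using c m n h(1) by (simp add: l_distr smult_assoc2 stdmon_closed p_def)
  finally have coeffs_fn: "coeffs (f \<otimes>\<^bsub>A\<^esub> stdmon n) q = c \<otimes>\<^bsub>R\<^esub> coeffs p q \<oplus>\<^bsub>R\<^esub> coeffs (h \<otimes>\<^bsub>A\<^esub> stdmon n) q" for q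
    using c p hn by (simp add: coeffs_add coeffs_smult)
  have fn: "f \<otimes>\<^bsub>A\<^esub> stdmon n \<in> carrier A"
    using f n by (simp add: stdmon_closed)
  have "coeffs p (LM r p) \<noteq> \<zero>\<^bsub>R\<^esub>"
    using LM_properties(1)[OF lin p] by (simp add: supp_iff)
  moreover have "coeffs (h \<otimes>\<^bsub>A\<^esub> stdmon n) (LM r p) = \<zero>\<^bsub>R\<^esub>"
    using hn(2) by (auto simp: supp_def)
  ultimately have lead: "LM r p \<in> supp (f \<otimes>\<^bsub>A\<^esub> stdmon n)"
    unfolding supp_iff coeffs_fn using c coeffs_closed[OF p(1)] by (simp add: integral_iff)
  then show ?nonzero
    using supp_eq_empty_iff[OF fn] by auto
  have "supp (f \<otimes>\<^bsub>A\<^esub> stdmon n) \<subseteq> supp p \<union> supp (h \<otimes>\<^bsub>A\<^esub> stdmon n)"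
    using c(1) by (auto simp: supp_iff coeffs_fn)
  then have "(q, LM r p) \<in> r" if "q \<in> supp (f \<otimes>\<^bsub>A\<^esub> stdmon n)" for q
    using that hn(2) LM_properties(2)[OF lin p] by blast
  then show ?LM
    unfolding m_def[symmetric] p_def[symmetric] by (intro LM_eqI lin fn lead)
qed

definition leading_monomials :: "('h multiset \<times> 'h multiset) set \<Rightarrow> 'a set \<Rightarrow> 'h multiset set" where
  "leading_monomials r I = LM r ` (I - {\<zero>\<^bsub>A\<^esub>})"

lemma leading_monomials_std:
  assumes "linear_order_on std r" "I \<subseteq> carrier A"
  shows "leading_monomials r I \<subseteq> std"
  using assms LM_std unfolding leading_monomials_def by blast

lemma LM_mult_leading_monomial:
  assumes r: "term_order r" and I: "ideal I A" and m: "m \<in> leading_monomials r I" and n: "n \<in> std"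
    and nz: "stdmon m \<otimes>\<^bsub>A\<^esub> stdmon n \<noteq> \<zero>\<^bsub>A\<^esub>"
  shows "LM r (stdmon m \<otimes>\<^bsub>A\<^esub> stdmon n) \<in> leading_monomials r I"
proof -
  interpret I: ideal I A by fact
  obtain f where f: "f \<in> I" "f \<noteq> \<zero>\<^bsub>A\<^esub>" "m = LM r f"
    using m by (auto simp: leading_monomials_def)
  have fA: "f \<in> carrier A"
    by (rule I.Icarr[OF f(1)])
  have "f \<otimes>\<^bsub>A\<^esub> stdmon n \<in> I"
    using f(1) n by (simp add: I.I_r_closed stdmon_closed)
  moreover note LM_mult_stdmon[OF r fA f(2) n nz[unfolded f(3)]]
  ultimately show ?thesis
    unfolding leading_monomials_def f(3) by (intro image_eqI[of _ _ "f \<otimes>\<^bsub>A\<^esub> stdmon n"]) simp_all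
qed

text \<open>Suppose the claim fails and take the least monomial \<open>n\<close> of degree \<open>s\<close> for which it does. It
  is not normal, so it is the leading monomial of some \<open>f \<in> I\<close>. The part \<open>g\<close> of \<open>f\<close> of degree \<open>s\<close> still lies in \<open>I\<close>
  and has leading monomial \<open>n\<close>; its other monomials are smaller and of degree \<open>s\<close>, so they are
  covered by minimality, and then so is \<open>n\<close>.\<close>

lemma normal_monomials_span:
  assumes r: "linear_order_on std r" and I: "ideal I A"
    and hom: "\<And>f s. f \<in> I \<Longrightarrow> hom_part d s f \<in> I"
    and fin: "finite {m \<in> std. mon_deg d m = s}"
    and m: "m \<in> std" "mon_deg d m = s"
  shows "stdmon m \<in> submodule_sum I (span (stdmon ` ({m \<in> std. mon_deg d m = s} - leading_monomials r I)))"
    (is "_ \<in> submodule_sum I ?V")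
proof (rule ccontr)
  let ?B = "submodule_sum I ?V"
  define S where "S = {m \<in> std. mon_deg d m = s \<and> stdmon m \<notin> ?B}"
  assume "stdmon m \<notin> ?B"
  then have "S \<noteq> {}" and "finite S" and "S \<subseteq> std"
    using m finite_subset[OF _ fin, of S] by (auto simp: S_def)
  \<comment> \<open>A greatest element for the converse order is a least element.\<close>
  then obtain n where n: "n \<in> S" and least: "\<And>q. q \<in> S \<Longrightarrow> (n, q) \<in> r"
    using finite_linear_order_ex_max[of std "r\<inverse>" S] r by auto
  have subI: "LinearCombinations.submodule R I A"
    by (rule ideal_submodule[OF I])
  have incl: "stdmon ` ({m \<in> std. mon_deg d m = s} - leading_monomials r I) \<subseteq> carrier A"
    by (intro stdmon_image_closed) auto
  have subV: "LinearCombinations.submodule R ?V A"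
    by (rule span_is_submodule[OF incl])
  have subB: "LinearCombinations.submodule R ?B A"
    by (rule sum_is_submodule[OF subI subV])
  have IB: "I \<subseteq> ?B"
    by (rule in_sum[OF subI subV])
  have VB: "?V \<subseteq> ?B"
    using in_sum[OF subV subI] msum_comm[OF subI subV] by simp
  have nstd: "n \<in> std" "mon_deg d n = s" "stdmon n \<notin> ?B"
    using n by (auto simp: S_def)
  have "n \<in> leading_monomials r I"
  proof (rule ccontr)
    assume "n \<notin> leading_monomials r I"
    then have "stdmon n \<in> ?V"
      using nstd by (intro subsetD[OF in_own_span[OF incl]]) auto
    then show False
      using VB nstd(3) by blast
  qed
  then obtain f where f: "f \<in> I" "f \<noteq> \<zero>\<^bsub>A\<^esub>" "n = LM r f"
    by (auto simp: leading_monomials_def)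
  have fA: "f \<in> carrier A"
    using LinearCombinations.submodule.subset[OF subI] f(1) by blast
  define g where "g = hom_part d s f"
  have g: "g \<in> I" "g \<in> carrier A" "supp g = {q \<in> supp f. mon_deg d q = s}"
    unfolding g_def using hom[OF f(1)] by (simp_all add: hom_part_closed supp_hom_part fA)
  have ng: "n \<in> supp g"
    using LM_properties(1)[OF r fA f(2)] nstd(2) by (simp add: g(3) f(3))
  obtain h where h: "h \<in> carrier A" "g = coeffs g n \<odot>\<^bsub>A\<^esub> stdmon n \<oplus>\<^bsub>A\<^esub> h" "supp h = supp g - {n}"
    using split_std_term[OF g(2) nstd(1)] .
  have "h \<in> ?B"
  proof (rule in_submodule_if_supp[OF subB h(1)])
    fix q assume "q \<in> supp h"
    then have q: "q \<in> supp f" "mon_deg d q = s" "q \<noteq> n"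
      by (auto simp: h(3) g(3))
    have "(q, n) \<in> r"
      using LM_properties(2)[OF r fA f(2) q(1)] by (simp add: f(3))
    then have "q \<notin> S"
      using least[of q] q(3) r by (auto simp: order_on_defs dest: antisymD)
    then show "stdmon q \<in> ?B"
      using q(2) supp_stdD[OF q(1) fA] by (auto simp: S_def)
  qed
  then have "g \<ominus>\<^bsub>A\<^esub> h \<in> ?B"
    using IB g(1) by (intro submodule_diff_closed[OF subB]) auto
  moreover have "g \<ominus>\<^bsub>A\<^esub> h = coeffs g n \<odot>\<^bsub>A\<^esub> stdmon n"
    by (subst h(2)) (use h(1) nstd(1) coeffs_closed[OF g(2)] in
      \<open>simp add: M.minus_eq M.a_assoc M.r_neg std_term_closed\<close>)
  ultimately have "stdmon n \<in> ?B"
    using ng by (intro submodule_smult_cancel[OF subB stdmon_closed[OF nstd(1)] coeffs_closed[OF g(2)]])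
      (auto simp: supp_iff)
  then show False
    using nstd(3) by simp
qed

section \<open>Dimensions of the components of a quotient\<close>

text \<open>The union that defines the scalar multiple ranges over all representatives, and all of them
  give the same coset.\<close>

lemma quot_algebra_smult:
  assumes "ideal I A" and c: "c \<in> carrier R" and a: "a \<in> carrier A"
  shows "c \<odot>\<^bsub>quot_algebra A I\<^esub> (I +>\<^bsub>A\<^esub> a) = I +>\<^bsub>A\<^esub> (c \<odot>\<^bsub>A\<^esub> a)"
proof -
  interpret I: ideal I A by fact
  have eq: "I +>\<^bsub>A\<^esub> (c \<odot>\<^bsub>A\<^esub> b) = I +>\<^bsub>A\<^esub> (c \<odot>\<^bsub>A\<^esub> a)" if b: "b \<in> I +>\<^bsub>A\<^esub> a" for b
  proof -
    obtain i where i: "i \<in> I" "b = i \<oplus>\<^bsub>A\<^esub> a"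
      using b by (auto simp: a_r_coset_def r_coset_def)
    have "c \<odot>\<^bsub>A\<^esub> i \<in> I"
      by (rule LinearCombinations.submodule.smult_closed[OF ideal_submodule[OF assms(1)] c i(1)])
    moreover have "c \<odot>\<^bsub>A\<^esub> b = c \<odot>\<^bsub>A\<^esub> i \<oplus>\<^bsub>A\<^esub> c \<odot>\<^bsub>A\<^esub> a"
      using c a I.Icarr[OF i(1)] by (simp add: i(2) smult_r_distr)
    ultimately have "c \<odot>\<^bsub>A\<^esub> b \<in> I +>\<^bsub>A\<^esub> (c \<odot>\<^bsub>A\<^esub> a)"
      by (auto simp: a_r_coset_def r_coset_def)
    then show ?thesis
      using c a by (intro I.a_repr_independence'[symmetric]) simp_all
  qed
  have "a \<in> I +>\<^bsub>A\<^esub> a"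
    by (rule I.a_rcos_self[OF a])
  then have "(\<Union>b\<in>I +>\<^bsub>A\<^esub> a. I +>\<^bsub>A\<^esub> (c \<odot>\<^bsub>A\<^esub> b)) = I +>\<^bsub>A\<^esub> (c \<odot>\<^bsub>A\<^esub> a)"
    using eq by blast
  then show ?thesis
    by (simp add: quot_algebra_def ring.defs module.defs)
qed

lemma quot_algebra_simps:
  assumes "ideal I A"
  shows "carrier (quot_algebra A I) = (\<lambda>a. I +>\<^bsub>A\<^esub> a) ` carrier A"
    and "\<zero>\<^bsub>quot_algebra A I\<^esub> = I +>\<^bsub>A\<^esub> \<zero>\<^bsub>A\<^esub>"
    and "a \<in> carrier A \<Longrightarrow> b \<in> carrier A \<Longrightarrow>
      (I +>\<^bsub>A\<^esub> a) \<oplus>\<^bsub>quot_algebra A I\<^esub> (I +>\<^bsub>A\<^esub> b) = I +>\<^bsub>A\<^esub> (a \<oplus>\<^bsub>A\<^esub> b)"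
proof -
  interpret I: ideal I A by fact
  show "carrier (quot_algebra A I) = (\<lambda>a. I +>\<^bsub>A\<^esub> a) ` carrier A"
    by (auto simp: quot_algebra_def ring.defs module.defs FactRing_def A_RCOSETS_def')
  show "\<zero>\<^bsub>quot_algebra A I\<^esub> = I +>\<^bsub>A\<^esub> \<zero>\<^bsub>A\<^esub>"
    by (simp add: quot_algebra_def ring.defs module.defs FactRing_def M.a_coset_add_zero I.a_subset)
  show "(I +>\<^bsub>A\<^esub> a) \<oplus>\<^bsub>quot_algebra A I\<^esub> (I +>\<^bsub>A\<^esub> b) = I +>\<^bsub>A\<^esub> (a \<oplus>\<^bsub>A\<^esub> b)"
    if "a \<in> carrier A" "b \<in> carrier A"
    using that by (simp add: quot_algebra_def ring.defs module.defs FactRing_def I.a_rcos_sum)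
qed

text \<open>Every element of the quotient is the coset of an element of \<open>A\<close>, and taking cosets commutes with
  the operations, so each axiom carries over from \<open>A\<close>.\<close>

lemma quot_vectorspace:
  assumes I: "ideal I A"
  shows "vectorspace R (quot_algebra A I)"
proof -
  let ?Q = "quot_algebra A I" and ?T = "\<lambda>a. I +>\<^bsub>A\<^esub> a"
  note carrier = quot_algebra_simps(1)[OF I] and ops = quot_algebra_simps(2,3)[OF I] quot_algebra_smult[OF I]
  have T: "?T a \<in> carrier ?Q" if "a \<in> carrier A" for a
    using that unfolding carrier by (rule imageI)
  have coset: "\<exists>a\<in>carrier A. v = ?T a" if "v \<in> carrier ?Q" for v
    using that unfolding carrier by blast
  show ?thesis
  proof (rule vs_criteria, goal_cases)
    case 1
    show ?case by (rule field_axioms)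
  next
    case 2
    show ?case using T[of "\<zero>\<^bsub>A\<^esub>"] by (simp add: ops)
  next
    case 3
    show ?case using T by (auto simp: ops dest!: coset)
  next
    case 4
    show ?case
    proof
      fix v assume "v \<in> carrier ?Q"
      then obtain a where a: "a \<in> carrier A" "v = ?T a"
        using coset by blast
      then have "v \<oplus>\<^bsub>?Q\<^esub> ?T (\<ominus>\<^bsub>A\<^esub> a) = \<zero>\<^bsub>?Q\<^esub>"
        by (simp add: ops M.r_neg)
      then show "\<exists>w\<in>carrier ?Q. v \<oplus>\<^bsub>?Q\<^esub> w = \<zero>\<^bsub>?Q\<^esub>"
        using T[of "\<ominus>\<^bsub>A\<^esub> a"] a(1) by auto
    qed
  next
    case 5
    show ?case using T by (auto simp: ops dest!: coset)
  next
    case 6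
    show ?case by (auto simp: ops M.a_comm dest!: coset)
  next
    case 7
    show ?case by (auto simp: ops M.a_assoc dest!: coset)
  next
    case 8
    show ?case by (auto simp: ops dest!: coset)
  next
    case 9
    show ?case by (auto simp: ops smult_assoc1 dest!: coset)
  next
    case 10
    show ?case by (auto simp: ops dest!: coset)
  next
    case 11
    show ?case by (auto simp: ops smult_l_distr dest!: coset)
  next
    case 12
    show ?case by (auto simp: ops smult_r_distr dest!: coset)
  qed
qed

lemma dim_span_stdmon:
  assumes N: "N \<subseteq> std" "finite N"
  shows "vectorspace.dim R (vs (span (stdmon ` N))) = card N"
    and "vectorspace.fin_dim R (vs (span (stdmon ` N)))"
proof -
  let ?V = "span (stdmon ` N)"
  have sub: "LinearCombinations.submodule R ?V A"
    using N by (intro span_is_submodule stdmon_image_closed)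
  have sp: "VectorSpace.subspace R ?V A"
    using N by (intro span_is_subspace stdmon_image_closed)
  interpret V: vectorspace R "vs ?V"
    by (rule subspace_is_vs[OF sp])
  have incl: "stdmon ` N \<subseteq> ?V"
    using N by (intro in_own_span stdmon_image_closed)
  have "stdmon ` N \<subseteq> stdmon ` std" and "lin_indpt (stdmon ` std)"
    using N(1) standard_basis unfolding basis_def std_def[symmetric] by auto
  then have "lin_indpt (stdmon ` N)"
    by (rule subset_li_is_li[rotated])
  then have basis: "V.basis (stdmon ` N)"
    unfolding V.basis_def span_li_not_depend[OF incl sub] using incl by simp
  have "V.dim = card (stdmon ` N)"
    by (rule V.dim_basis[OF _ basis]) (simp add: N(2))
  then show "V.dim = card N"
    by (simp add: card_image stdmon_inj[OF N(1)])
  show "V.fin_dim"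
    unfolding V.fin_dim_def using basis N(2) unfolding V.basis_def by blast
qed

text \<open>The span of \<open>N\<close> is a complement of \<open>I\<close> within degree \<open>s\<close>: the projection to the quotient is
  injective on it and maps it onto the component of degree \<open>s\<close>, so rank and nullity give the
  dimension.\<close>

lemma dim_quot_component:
  assumes I: "ideal I A" and N: "N \<subseteq> {m \<in> std. mon_deg d m = s}" "finite N"
    and indep: "\<And>f. f \<in> I \<Longrightarrow> supp f \<subseteq> N \<Longrightarrow> f = \<zero>\<^bsub>A\<^esub>"
    and spanning: "\<And>m. m \<in> std \<Longrightarrow> mon_deg d m = s \<Longrightarrow> stdmon m \<in> submodule_sum I (span (stdmon ` N))"
  shows "vectorspace.dim R ((quot_algebra A I)\<lparr>carrier := quot_component d I s\<rparr>) = card N"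
proof -
  interpret I: ideal I A by fact
  let ?V = "span (stdmon ` N)" and ?Q = "quot_algebra A I" and ?T = "\<lambda>a. I +>\<^bsub>A\<^esub> a"
  have Nstd: "N \<subseteq> std"
    using N(1) by auto
  note V_eq = span_stdmon[OF Nstd]
  interpret V: vectorspace R "vs ?V"
    by (intro subspace_is_vs span_is_subspace stdmon_image_closed Nstd)
  interpret Q: vectorspace R ?Q
    by (rule quot_vectorspace[OF I])
  have "?T \<in> LinearCombinations.module_hom R (vs ?V) ?Q"
    unfolding LinearCombinations.module_hom_def V_eq by (auto simp: quot_algebra_simps[OF I] quot_algebra_smult[OF I])
  then interpret T: linear_map R "vs ?V" ?Q ?T
    by unfold_locales
  have V_component: "?V \<subseteq> component d s"
    unfolding component_def using N(1) by (intro span_is_monotone image_mono)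
  have "?T ` component d s \<subseteq> ?T ` ?V"
  proof
    fix q assume "q \<in> ?T ` component d s"
    then obtain a where a: "a \<in> component d s" "q = ?T a"
      by auto
    have "component d s \<subseteq> submodule_sum I ?V"
      unfolding component_def
      by (intro span_is_subset sum_is_submodule ideal_submodule I span_is_submodule stdmon_image_closed Nstd)
        (auto intro: spanning)
    then obtain i v where iv: "i \<in> I" "v \<in> ?V" "a = i \<oplus>\<^bsub>A\<^esub> v"
      using a(1) by (auto simp: submodule_sum_def)
    then have "?T a = ?T v"
      by (intro I.a_repr_independence'[symmetric]) (auto simp: a_r_coset_def r_coset_def V_eq)
    then show "q \<in> ?T ` ?V"
      using a iv by auto
  qed
  then have image: "quot_component d I s = T.im"
    unfolding quot_component_def T.im_def using V_component by auto
  have "inj_on ?T ?V"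
  proof (rule inj_onI)
    fix v w assume vw: "v \<in> ?V" "w \<in> ?V" "?T v = ?T w"
    then have cl: "v \<in> carrier A" "w \<in> carrier A"
      by (auto simp: V_eq)
    have sub: "LinearCombinations.submodule R ?V A"
      by (intro span_is_submodule stdmon_image_closed Nstd)
    have "v \<ominus>\<^bsub>A\<^esub> w \<in> ?V"
      by (rule submodule_diff_closed[OF sub vw(1,2)])
    moreover have "v \<in> I +>\<^bsub>A\<^esub> w"
      using vw(3) I.a_rcos_self[OF cl(1)] by simp
    then obtain i where i: "i \<in> I" "v = i \<oplus>\<^bsub>A\<^esub> w"
      by (auto simp: a_r_coset_def r_coset_def)
    then have "v \<ominus>\<^bsub>A\<^esub> w = i"
      using cl I.Icarr[OF i(1)] by (simp add: M.minus_eq M.a_assoc M.r_neg)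
    then have "v \<ominus>\<^bsub>A\<^esub> w \<in> I"
      using i(1) by simp
    ultimately have "v \<ominus>\<^bsub>A\<^esub> w = \<zero>\<^bsub>A\<^esub>"
      using indep by (auto simp: V_eq)
    then show "v = w"
      using cl by simp
  qed
  then have "vectorspace.dim R (V.vs T.ker) = 0"
    using T.inj_imp_dim_ker0 by simp
  then have "vectorspace.dim R (Q.vs T.im) = V.dim"
    using T.rank_nullity[OF dim_span_stdmon(2)[OF Nstd N(2)]] by simp
  then show ?thesis
    using image dim_span_stdmon(1)[OF Nstd N(2)] by simp
qed

end

section \<open>The leading ideal\<close>

context algebra_of_leading_terms
begin

lemma pi_std_term:
  assumes "m \<in> A.std" "c \<in> carrier R"
  shows "\<pi> (c \<odot>\<^bsub>A\<^esub> A.stdmon m) = c \<odot>\<^bsub>L\<^esub> L.stdmon m"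
proof -
  interpret linear_map R A L \<pi> by (rule pi_linear)
  show ?thesis
    using assms by (simp add: A.stdmon_closed pi_standard)
qed

lemma pi_closed: "f \<in> carrier A \<Longrightarrow> \<pi> f \<in> carrier L"
  using pi_bij by (auto simp: bij_betw_def)

lemma pi_zero: "\<pi> \<zero>\<^bsub>A\<^esub> = \<zero>\<^bsub>L\<^esub>"
proof -
  interpret linear_map R A L \<pi> by (rule pi_linear)
  show ?thesis by simp
qed

lemma pi_LT:
  assumes "linear_order_on A.std r" "f \<in> carrier A" "f \<noteq> \<zero>\<^bsub>A\<^esub>"
  shows "\<pi> (A.LT r f) = A.coeffs f (A.LM r f) \<odot>\<^bsub>L\<^esub> L.stdmon (A.LM r f)"
  using assms by (simp add: A.LT_def pi_std_term A.LM_std A.coeffs_closed)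

lemma pi_LT_closed:
  assumes "linear_order_on A.std r" "f \<in> carrier A"
  shows "\<pi> (A.LT r f) \<in> carrier L"
  using assms by (intro pi_closed) (auto simp: A.LT_def A.LM_std A.coeffs_closed A.stdmon_closed)

lemma stdmon_mult_cases:
  assumes r: "linear_order_on A.std r" and mn: "m \<in> A.std" "n \<in> A.std"
  obtains "L.stdmon m \<otimes>\<^bsub>L\<^esub> L.stdmon n = \<zero>\<^bsub>L\<^esub>"
  | c where "A.stdmon m \<otimes>\<^bsub>A\<^esub> A.stdmon n \<noteq> \<zero>\<^bsub>A\<^esub>" "c \<in> carrier R"
      "L.stdmon m \<otimes>\<^bsub>L\<^esub> L.stdmon n = c \<odot>\<^bsub>L\<^esub> L.stdmon (A.LM r (A.stdmon m \<otimes>\<^bsub>A\<^esub> A.stdmon n))"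
proof -
  let ?p = "A.stdmon m \<otimes>\<^bsub>A\<^esub> A.stdmon n"
  have p: "?p \<in> carrier A"
    using mn by (simp add: A.stdmon_closed)
  have "L.stdmon m \<otimes>\<^bsub>L\<^esub> L.stdmon n \<in> {\<zero>\<^bsub>L\<^esub>, \<pi> (A.LT r ?p)}"
    using pi_mult[OF mn] by (simp only: pi_standard[OF mn(1)] pi_standard[OF mn(2)])
  moreover have "\<pi> (A.LT r ?p) = \<zero>\<^bsub>L\<^esub>" if "?p = \<zero>\<^bsub>A\<^esub>"
    using that by (simp add: A.LT_def pi_zero)
  ultimately consider (zero) "L.stdmon m \<otimes>\<^bsub>L\<^esub> L.stdmon n = \<zero>\<^bsub>L\<^esub>"
    | (LT) "?p \<noteq> \<zero>\<^bsub>A\<^esub>" "L.stdmon m \<otimes>\<^bsub>L\<^esub> L.stdmon n = \<pi> (A.LT r ?p)"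
    by fastforce
  then show thesis
  proof cases
    case zero
    then show thesis
      by (rule that(1))
  next
    case LT
    show thesis
      by (rule that(2)[OF LT(1) A.coeffs_closed[OF p]]) (simp only: LT(2) pi_LT[OF r p LT(1)])
  qed
qed

text \<open>In \<open>A\<close> the product of two standard monomials is homogeneous of the right degree, hence so is its
  leading monomial, which is the only monomial that can occur in the corresponding product in \<open>L\<close>.\<close>

lemma leading_terms_graded:
  assumes r: "linear_order_on A.std r" and graded: "A.graded d"
  shows "L.graded d"
proof (rule L.gradedI)
  fix m n assume mn: "m \<in> L.std" "n \<in> L.std"
  let ?p = "A.stdmon m \<otimes>\<^bsub>A\<^esub> A.stdmon n"
  have sub: "LinearCombinations.submodule R (L.component d (mon_deg d m + mon_deg d n)) L"
    by (rule L.component_submodule)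
  have p: "?p \<in> carrier A"
    using mn by (simp add: A.stdmon_closed)
  show "L.stdmon m \<otimes>\<^bsub>L\<^esub> L.stdmon n \<in> L.component d (mon_deg d m + mon_deg d n)"
    using r mn
  proof (cases rule: stdmon_mult_cases)
    case 1
    then show ?thesis
      using LinearCombinations.submodule.zero_closed[OF sub] by simp
  next
    case (2 c)
    have "A.stdmon k \<in> A.component d (mon_deg d k)" if "k \<in> A.std" for k
      using that by (simp add: A.component_eq A.stdmon_closed A.supp_stdmon)
    then have "?p \<in> A.component d (mon_deg d m + mon_deg d n)"
      using graded mn unfolding A.graded_def by blast
    then have "mon_deg d (A.LM r ?p) = mon_deg d m + mon_deg d n"
      using A.LM_properties(1)[OF r p 2(1)] by (simp add: A.component_eq)
    then have "L.stdmon (A.LM r ?p) \<in> L.component d (mon_deg d m + mon_deg d n)"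
      using A.LM_std[OF r p 2(1)] by (simp add: L.component_eq L.stdmon_closed L.supp_stdmon)
    then show ?thesis
      using 2(2,3) LinearCombinations.submodule.smult_closed[OF sub] by simp
  qed
qed

text \<open>The linear span \<open>?J\<close> of the leading monomials contains the generators of the leading ideal, and
  it is an ideal because the product of a leading monomial with a standard monomial is zero or a
  multiple of a leading monomial. Conversely, a leading monomial differs from a generator only by
  an invertible scalar.\<close>

lemma
  assumes r: "A.term_order r" and I: "ideal I A"
  shows leading_ideal_eq: "leading_ideal I = {f \<in> carrier L. L.supp f \<subseteq> A.leading_monomials r I}"
      (is "_ = ?J")
    and leading_ideal_ideal: "ideal (leading_ideal I) L"
proof -
  let ?G = "{\<pi> (A.LT r f) | f. f \<in> I}"
  interpret I: ideal I A by fact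
  have lin: "linear_order_on A.std r"
    using r by (simp add: A.term_order_def)
  have G: "?G \<subseteq> carrier L"
    using pi_LT_closed[OF lin I.Icarr] by auto
  show ideal: "ideal (leading_ideal I) L"
    unfolding leading_ideal_def by (rule L.genideal_ideal[OF G])
  have subJ: "LinearCombinations.submodule R ?J L"
    by (rule L.supp_subset_submodule)
  note M_std = A.leading_monomials_std[OF lin I.a_subset]
  have stdmon_J: "c \<odot>\<^bsub>L\<^esub> L.stdmon m \<in> ?J" if "m \<in> A.leading_monomials r I" "c \<in> carrier R" for m c
  proof (rule LinearCombinations.submodule.smult_closed[OF subJ that(2)])
    show "L.stdmon m \<in> ?J"
      using M_std that(1) L.stdmon_closed[of m] L.supp_stdmon[of m] by auto
  qed
  have "ideal ?J L"
  proof (rule L.submodule_idealI[OF subJ])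
    fix a b assume a: "a \<in> carrier L" and b: "b \<in> ?J"
    then have bL: "b \<in> carrier L"
      by simp
    show "a \<otimes>\<^bsub>L\<^esub> b \<in> ?J"
    proof (rule L.mult_in_submodule_if_supp[OF subJ a bL])
      fix n m assume n: "n \<in> L.supp a" and "m \<in> L.supp b"
      then have m: "m \<in> A.leading_monomials r I"
        using b by auto
      have mstd: "m \<in> A.std" and nstd: "n \<in> A.std"
        using M_std m L.supp_stdD[OF n a] by auto
      have "L.stdmon m \<otimes>\<^bsub>L\<^esub> L.stdmon n \<in> ?J"
        using lin mstd nstd
      proof (cases rule: stdmon_mult_cases)
        case 1
        then show ?thesis
          using LinearCombinations.submodule.zero_closed[OF subJ] by simp
      next
        case (2 c)
        show ?thesis
          unfolding 2(3) by (rule stdmon_J[OF A.LM_mult_leading_monomial[OF r I m nstd 2(1)] 2(2)])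
      qed
      then show "L.stdmon n \<otimes>\<^bsub>L\<^esub> L.stdmon m \<in> ?J"
        using L.m_comm[OF L.stdmon_closed[OF mstd] L.stdmon_closed[OF nstd]] by simp
    qed
  qed
  moreover have "?G \<subseteq> ?J"
  proof
    fix q assume "q \<in> ?G"
    then obtain f where f: "f \<in> I" "q = \<pi> (A.LT r f)"
      by auto
    show "q \<in> ?J"
    proof (cases "f = \<zero>\<^bsub>A\<^esub>")
      case True
      then show ?thesis
        using f(2) LinearCombinations.submodule.zero_closed[OF subJ] by (simp add: A.LT_def pi_zero)
    next
      case False
      then have "A.LM r f \<in> A.leading_monomials r I"
        using f(1) by (simp add: A.leading_monomials_def)
      then show ?thesis
        unfolding f(2) pi_LT[OF lin I.Icarr[OF f(1)] False]
        by (rule stdmon_J) (rule A.coeffs_closed[OF I.Icarr[OF f(1)]])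
    qed
  qed
  ultimately have "leading_ideal I \<subseteq> ?J"
    unfolding leading_ideal_def by (rule L.genideal_minimal)
  moreover have "f \<in> leading_ideal I" if f: "f \<in> ?J" for f
  proof (rule L.in_submodule_if_supp[OF L.ideal_submodule[OF ideal]])
    fix m assume "m \<in> L.supp f"
    then have "m \<in> A.leading_monomials r I"
      using f by auto
    then obtain g where g: "g \<in> I" "g \<noteq> \<zero>\<^bsub>A\<^esub>" "m = A.LM r g"
      by (auto simp: A.leading_monomials_def)
    have gA: "g \<in> carrier A"
      by (rule I.Icarr[OF g(1)])
    have "\<pi> (A.LT r g) \<in> leading_ideal I"
      using L.genideal_self[OF G] g(1) unfolding leading_ideal_def by blast
    then have "A.coeffs g m \<odot>\<^bsub>L\<^esub> L.stdmon m \<in> leading_ideal I"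
      using pi_LT[OF lin gA g(2)] by (simp add: g(3))
    moreover have "A.coeffs g m \<noteq> \<zero>\<^bsub>R\<^esub>"
      using A.LM_properties(1)[OF lin gA g(2)] by (simp add: A.supp_iff g(3))
    moreover have "L.stdmon m \<in> carrier L"
      using A.LM_std[OF lin gA g(2)] by (simp add: g(3) L.stdmon_closed)
    ultimately show "L.stdmon m \<in> leading_ideal I"
      using L.submodule_smult_cancel[OF L.ideal_submodule[OF ideal]] A.coeffs_closed[OF gA] by blast
  qed (use f in simp)
  ultimately show "leading_ideal I = ?J"
    by blast
qed

text \<open>Both dimensions are the number of normal monomials of degree \<open>s\<close>.\<close>

lemma dim_quot_components:
  assumes r: "A.term_order r" and I: "ideal I A"
    and hom: "\<And>f s. f \<in> I \<Longrightarrow> A.hom_part d s f \<in> I"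
    and fin: "finite {m \<in> A.std. mon_deg d m = s}"
  shows "vectorspace.dim R ((quot_algebra A I)\<lparr>carrier := A.quot_component d I s\<rparr>) =
    vectorspace.dim R ((quot_algebra L (leading_ideal I))\<lparr>carrier := L.quot_component d (leading_ideal I) s\<rparr>)"
proof -
  let ?M = "A.leading_monomials r I"
  let ?N = "{m \<in> A.std. mon_deg d m = s} - ?M"
  interpret I: ideal I A by fact
  have lin: "linear_order_on A.std r"
    using r by (simp add: A.term_order_def)
  note J = leading_ideal_eq[OF r I] leading_ideal_ideal[OF r I]
  have N: "?N \<subseteq> {m \<in> A.std. mon_deg d m = s}" "finite ?N"
    using fin by auto
  have "vectorspace.dim R ((quot_algebra A I)\<lparr>carrier := A.quot_component d I s\<rparr>) = card ?N"
  proof (rule A.dim_quot_component[OF I N])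
    fix f assume f: "f \<in> I" "A.supp f \<subseteq> ?N"
    show "f = \<zero>\<^bsub>A\<^esub>"
    proof (rule ccontr)
      assume nz: "f \<noteq> \<zero>\<^bsub>A\<^esub>"
      then have "A.LM r f \<in> ?M"
        using f(1) by (simp add: A.leading_monomials_def)
      then show False
        using A.LM_properties(1)[OF lin I.Icarr[OF f(1)] nz] f(2) by blast
    qed
  qed (rule A.normal_monomials_span[OF lin I hom fin])
  moreover have "vectorspace.dim R
      ((quot_algebra L (leading_ideal I))\<lparr>carrier := L.quot_component d (leading_ideal I) s\<rparr>) = card ?N"
  proof (rule L.dim_quot_component[OF J(2) N])
    fix f assume f: "f \<in> leading_ideal I" "L.supp f \<subseteq> ?N"
    then have "f \<in> carrier L" "L.supp f \<subseteq> ?M"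
      unfolding J(1) by auto
    then show "f = \<zero>\<^bsub>L\<^esub>"
      using f(2) L.supp_eq_empty_iff by blast
  next
    fix m assume m: "m \<in> L.std" "mon_deg d m = s"
    have incl: "L.stdmon ` ?N \<subseteq> carrier L"
      by (intro L.stdmon_image_closed) auto
    note subs = L.ideal_submodule[OF J(2)] L.span_is_submodule[OF incl]
    show "L.stdmon m \<in> L.submodule_sum (leading_ideal I) (L.span (L.stdmon ` ?N))"
    proof (cases "m \<in> ?M")
      case True
      then have "L.stdmon m \<in> leading_ideal I"
        unfolding J(1) using m(1) by (simp add: L.stdmon_closed L.supp_stdmon)
      then show ?thesis
        by (rule subsetD[OF L.in_sum[OF subs]])
    next
      case False
      then have "L.stdmon m \<in> L.span (L.stdmon ` ?N)"
        using m by (intro subsetD[OF L.in_own_span[OF incl]]) auto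
      then show ?thesis
        using L.in_sum[OF subs(2,1)] L.msum_comm[OF subs] by auto
    qed
  qed
  ultimately show ?thesis
    by simp
qed

end

section \<open>Equality of the Hilbert series\<close>

theorem theorem8p5:
  fixes R :: "('k, 'r) ring_scheme"
    and A :: "('k, 'a, 'b) module_scheme"
    and L :: "('k, 'c, 'e) module_scheme"
    and H :: "'h set" and Sig :: "'h multiset set"
    and x :: "'h \<Rightarrow> 'a" and y :: "'h \<Rightarrow> 'c"
    and r :: "('h multiset \<times> 'h multiset) set"
    and \<pi> :: "'a \<Rightarrow> 'c"
    and d :: "'h \<Rightarrow> nat"
    and I :: "'a set"
  assumes "pseudo_ASL R A H x Sig"
    and "pseudo_ASL.term_order R A H x Sig r"
    and "algebra_of_leading_terms R A H x Sig r L y \<pi>"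
    and "\<And>h. h \<in> H \<Longrightarrow> d h \<ge> 1"
    and "pseudo_ASL.graded R A H x Sig d"
    and "pseudo_ASL.graded_order H Sig d r"
    and "ideal I A"
    and "pseudo_ASL.homogeneous R A H x Sig d I"
  defines "LI \<equiv> algebra_of_leading_terms.leading_ideal R A H x Sig r L \<pi> I"
  shows "pseudo_ASL R L H y Sig \<and> pseudo_ASL.graded R L H y Sig d \<and>
         pseudo_ASL.homogeneous R L H y Sig d LI \<and>
         pseudo_ASL.quot_hilbert_series R A H x Sig d I =
         pseudo_ASL.quot_hilbert_series R L H y Sig d LI"
proof -
  interpret algebra_of_leading_terms R A H x Sig r L y \<pi>
    by fact
  have r: "A.term_order r" and I: "ideal I A"
    by fact+
  have lin: "linear_order_on A.std r"
    using r by (simp add: A.term_order_def)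
  have LI: "LI = {f \<in> carrier L. L.supp f \<subseteq> A.leading_monomials r I}"
    unfolding LI_def by (rule leading_ideal_eq[OF r I])
  have hom: "A.hom_part d s f \<in> I" if "f \<in> I" for f s
    using assms(8) that A.is_direct_sum_iff_hom_part_closed[OF A.ideal_submodule[OF I]]
    by (simp add: A.homogeneous_def)
  have fin: "finite {m \<in> A.std. mon_deg d m = s}" for s
    using finite_mon_deg_eq[where s = s, OF A.finite_H assms(4)] by (rule finite_subset[rotated]) (auto simp: A.std_def)
  have "L.homogeneous d LI"
    unfolding L.homogeneous_def LI L.is_direct_sum_iff_hom_part_closed[OF L.supp_subset_submodule]
    by (auto simp: L.hom_part_closed L.supp_hom_part)
  moreover have "A.quot_hilbert_series d I = L.quot_hilbert_series d LI"
    unfolding A.quot_hilbert_series_def L.quot_hilbert_series_def hilbert_series_def LI_def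
    by (simp add: dim_quot_components[OF r I hom fin])
  ultimately show ?thesis
    using L.pseudo_ASL_axioms leading_terms_graded[OF lin assms(5)] by blast
qed

end
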